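(* (i) There is an absolute constant $C>0$ such that the following holds. Let $p$ be a prime, $R\subseteq \mathbb{F}_p^*$ a multiplicative subgroup and $l\ge 4$ an integer. If $|R| \ge C \min\{ p^{\frac{2l+2}{5l-3}}, p^{\frac{l+5}{3l+3}} \}$, then $\mathbb{F}^*_p \subseteq lR$. (ii) Let $p$ be a prime, $R\subseteq \mathbb{F}_p^*$ a multiplicative subgroup and $l\ge 2$ an integer. If $|R|>p^{\frac{l+1}{2l}}$, then $\mathbb{F}^*_p \subseteq lR$.
   Context: $lR=\{r_1+\dots+r_l : r_i\in R\}$ denotes the $l$-fold sumset of $R$. *)

theory Defs
  imports Complex_Main "HOL-Computational_Algebra.Primes"
begin

text \<open>F_p is modelled by the residues {0..<p} (naturals), with F_p^* = {1..<p}.\<close>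

definition mult_subgroup :: "nat \<Rightarrow> nat set \<Rightarrow> bool" where
  "mult_subgroup p R \<longleftrightarrow> R \<subseteq> {1..<p} \<and> 1 \<in> R \<and>
     (\<forall>x\<in>R. \<forall>y\<in>R. (x * y) mod p \<in> R) \<and>
     (\<forall>x\<in>R. \<exists>y\<in>R. (x * y) mod p = 1)"

fun sumset_mod :: "nat \<Rightarrow> nat \<Rightarrow> nat set \<Rightarrow> nat set" where
  "sumset_mod p 0 R = {0}"
| "sumset_mod p (Suc l) R = {(a + r) mod p | a r. a \<in> sumset_mod p l R \<and> r \<in> R}"

end

theory Submission
  imports Defs "HOL-Computational_Algebra.Polynomial" "HOL-Number_Theory.Cong"
    "HOL-Library.FuncSet" "HOL-Analysis.Convex"
begin

text \<open>
  Write t = |R| and S(\<xi>) for the Fourier transform of R at \<xi>, and let M be the maximum of |S|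
  over \<xi> \<noteq> 0. If a is missing from lR, so is the whole coset aR, and orthogonality of characters
  gives t^(l+1) \<le> \<Sum> |S(\<xi>)|^l |S(a\<xi>)| over \<xi> \<noteq> 0.
  With M^2 \<le> p and the second moment \<Sum> |S|^2 = pt this yields part (ii).

  For part (i) the fourth moment \<Sum> |S|^4 = pE is used instead, where E is the additive energy of R.
  Since S is constant on cosets of R, one has t M^4 \<le> pE and M^8 \<le> p E^2. The bound
  E = O(t^(5/2)) of Heath-Brown and Konyagin for t = O(p^(2/3)) then gives both exponents. It is
  proved by Stepanov's method: an auxiliary polynomial, found by the pigeonhole principle, vanishes
  to high order at all y with y^t = (y+1)^t in a prescribed set of values. The range t > p^(5/8)
  is covered by part (ii).

  As there is no type of residues modulo a variable p, polynomials over F_p are represented by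
  integer polynomials, and f = 0 in F_p[Y] is expressed as [:p:] dvd f.
\<close>

section \<open>Polynomials modulo a prime\<close>

text \<open>The exponent 5/2 comes from cutting the representation counts at sqrt t. For \<tau>
  \<ge> sqrt t only O(t^3 / \<tau>^3) nonzero differences have at least \<tau> representations, so
  the layers above the cut contribute about t^3 times the sum of 1 / \<tau>^2, which is t^3 / sqrt
  t; those below contribute sqrt t times t^2, the total number of pairs.

  The difficulty in Stepanov's method is to force a high order of vanishing with few linear
  conditions. In a combination of the products Y^a Y^(tc) (Y+1)^(tb), each derivative at y becomes a
  short polynomial in y once y^t and (y+1)^t are replaced by their common value z, so conditions are
  paid per z and not per y. The price is that the combination must be shown nonzero modulo p, for
  which the exponents a + tc have to stay below p; this is the source of the restriction 16 t^3
  \<le> p^2.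

  As t^(5/2) has a half-integer exponent, the energy bound is used squared, and with it the eighth
  power of M.\<close>

lemma nontrivial_solution_mod:
  fixes c :: "'j \<Rightarrow> 'i \<Rightarrow> int" and q :: int
  assumes "finite I" "finite J" "card J < card I" "1 < q"
  obtains x where "\<exists>i\<in>I. \<not> q dvd x i" "\<And>j. j \<in> J \<Longrightarrow> q dvd (\<Sum>i\<in>I. x i * c j i)"
proof -
  \<comment> \<open>\<open>F\<close> holds q^|I| coefficient vectors and \<open>G\<close> only q^|J|
    vectors of values, so two coefficient vectors share their values; their difference is the
    solution. Entries are reduced residues, so distinct ones stay distinct modulo q.\<close>
  define F where "F = (I \<rightarrow>\<^sub>E {0..<q})"
  define G where "G = (J \<rightarrow>\<^sub>E {0..<q})"
  define \<phi> where "\<phi> = (\<lambda>x. \<lambda>j\<in>J. (\<Sum>i\<in>I. x i * c j i) mod q)"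
  have fin: "finite F" "finite G"
    unfolding F_def G_def using assms by (auto intro: finite_PiE)
  have "card F = nat q ^ card I" "card G = nat q ^ card J"
    unfolding F_def G_def using assms by (simp_all add: card_PiE)
  moreover have "1 < nat q" using assms by simp
  ultimately have "card G < card F" using assms(3) by simp
  moreover have "\<phi> ` F \<subseteq> G"
    unfolding \<phi>_def G_def using assms(4) by auto
  ultimately have "\<not> inj_on \<phi> F"
    using fin by (metis card_inj_on_le linorder_not_le)
  then obtain u v where uv: "u \<in> F" "v \<in> F" "u \<noteq> v" "\<phi> u = \<phi> v"
    by (auto simp: inj_on_def)
  then obtain i where i: "i \<in> I" "u i \<noteq> v i"
    unfolding F_def by (meson PiE_ext)
  have "u i \<in> {0..<q}" "v i \<in> {0..<q}" using uv i unfolding F_def by auto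
  then have "\<not> q dvd u i - v i"
    using i by (metis atLeastLessThan_iff mod_eq_dvd_iff mod_pos_pos_trivial)
  moreover have "q dvd (\<Sum>i\<in>I. (u i - v i) * c j i)" if "j \<in> J" for j
  proof -
    have "(\<Sum>i\<in>I. u i * c j i) mod q = (\<Sum>i\<in>I. v i * c j i) mod q"
      using fun_cong[OF uv(4), of j] that by (simp add: \<phi>_def)
    then show ?thesis
      by (simp add: mod_eq_dvd_iff left_diff_distrib sum_subtractf)
  qed
  ultimately show thesis using that[of "\<lambda>i. u i - v i"] i by blast
qed

lemma prime_elem_const_poly_int:
  fixes q :: int
  assumes "prime q"
  shows "prime_elem [:q:]"
  using assms by (intro lift_prime_elem_poly prime_imp_prime_elem)

lemma const_poly_dvd_linear_power_mult_iff:
  fixes q :: int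
  assumes "prime q"
  shows "[:q:] dvd [:c, 1:] ^ k * g \<longleftrightarrow> [:q:] dvd g"
proof -
  have pr: "prime_elem [:q:]" using assms by (rule prime_elem_const_poly_int)
  have "\<not> [:q:] dvd [:c, 1:]"
  proof
    assume "[:q:] dvd [:c, 1:]"
    then have "q dvd coeff [:c, 1:] 1" by (metis const_poly_dvd_iff)
    then show False using assms by (simp add: not_prime_unit)
  qed
  then show ?thesis
    using prime_elem_dvd_mult_iff[OF pr] prime_elem_dvd_power[OF pr] by blast
qed

lemma const_poly_dvd_imp_dvd_poly:
  fixes q :: int
  assumes "[:q:] dvd f"
  shows "q dvd poly f x"
  using assms by (auto elim!: dvdE)

lemma factor_root_mod:
  fixes q :: int
  assumes "q dvd poly f x"
  shows "\<exists>g. [:q:] dvd f - [:-x, 1:] * g"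
proof -
  have "f - [:-x, 1:] * synthetic_div f x = [:poly f x:]"
    using synthetic_div_correct'[of x f] by (simp add: algebra_simps)
  moreover have "[:q:] dvd [:poly f x:]" using assms by simp
  ultimately show ?thesis by metis
qed

text \<open>The powers of the linear factors at points distinct modulo q are pairwise coprime, so
  their product divides f modulo q. \<open>degree f\<close> is the degree over the integers, an
  upper bound for the one modulo q.\<close>

lemma card_mult_roots_mod_le_degree:
  fixes q :: int
  assumes q: "prime q" and S: "finite S"
    and inj: "\<And>x y. x \<in> S \<Longrightarrow> y \<in> S \<Longrightarrow> x \<noteq> y \<Longrightarrow> \<not> q dvd x - y"
    and van: "\<And>x. x \<in> S \<Longrightarrow> \<exists>g. [:q:] dvd f - [:-x, 1:] ^ k * g"
    and nz: "\<not> [:q:] dvd f"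
  shows "k * card S \<le> degree f"
proof -
  have "\<exists>g. [:q:] dvd f - (\<Prod>x\<in>S. [:-x, 1:] ^ k) * g"
    using S inj van
  proof (induction S rule: finite_induct)
    case empty
    show ?case by (auto intro: exI[of _ f])
  next
    case (insert y S)
    define Q where "Q = (\<Prod>x\<in>S. [:-x, 1:] ^ k)"
    obtain g where g: "[:q:] dvd f - Q * g"
      using insert unfolding Q_def by (metis insertCI)
    obtain u where u: "[:q:] dvd f - [:-y, 1:] ^ k * u"
      using insert.prems(2) by blast
    have Qy: "\<not> q dvd poly Q y"
    proof
      assume "q dvd poly Q y"
      then have "q dvd (\<Prod>x\<in>S. (y - x) ^ k)"
        by (simp add: Q_def poly_prod poly_power)
      then obtain x where x: "x \<in> S" "q dvd (y - x) ^ k"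
        using prime_dvd_prod_iff[OF insert.hyps(1) q] by auto
      then have "q dvd y - x" using q prime_dvd_power by auto
      with x show False using insert.prems(1)[of y x] insert.hyps(2) by auto
    qed
    \<comment> \<open>The power at \<open>y\<close> is moved into the cofactor \<open>g\<close> one
      factor at a time: comparing the two representations of \<open>f\<close>, cancelling (Y - y)^j
      and evaluating at y kills the \<open>u\<close> term because j < k, and \<open>poly Q y\<close>
      is a unit modulo q.\<close>
    have "j \<le> k \<Longrightarrow> \<exists>h. [:q:] dvd g - [:-y, 1:] ^ j * h" for j
    proof (induction j)
      case 0
      show ?case by (auto intro: exI[of _ g])
    next
      case (Suc j)
      then obtain h where h: "[:q:] dvd g - [:-y, 1:] ^ j * h" by auto
      have k: "[:-y, 1:] ^ k = [:-y, 1:] ^ j * [:-y, 1:] ^ (k - j)"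
        using Suc.prems by (simp flip: power_add)
      have "[:-y, 1:] ^ j * (Q * h - [:-y, 1:] ^ (k - j) * u)
          = (f - [:-y, 1:] ^ k * u) - (f - Q * g) - Q * (g - [:-y, 1:] ^ j * h)"
        unfolding k by (simp add: algebra_simps)
      moreover have "[:q:] dvd \<dots>" using dvd_diff[OF dvd_diff[OF u g] dvd_mult[OF h]] .
      ultimately have "[:q:] dvd Q * h - [:-y, 1:] ^ (k - j) * u"
        using const_poly_dvd_linear_power_mult_iff[OF q] by metis
      then have "q dvd poly (Q * h - [:-y, 1:] ^ (k - j) * u) y"
        by (rule const_poly_dvd_imp_dvd_poly)
      then have "q dvd poly Q y * poly h y"
        using Suc.prems by (simp add: poly_power power_0_left)
      then have "q dvd poly h y" using Qy q by (simp add: prime_dvd_mult_iff)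
      then obtain h' where "[:q:] dvd h - [:-y, 1:] * h'" using factor_root_mod by blast
      then have "[:q:] dvd (g - [:-y, 1:] ^ j * h) + [:-y, 1:] ^ j * (h - [:-y, 1:] * h')"
        by (rule dvd_add[OF h dvd_mult])
      then show ?case by (intro exI[of _ h']) (simp add: algebra_simps)
    qed
    then obtain h where h: "[:q:] dvd g - [:-y, 1:] ^ k * h" by auto
    have "[:q:] dvd (f - Q * g) + Q * (g - [:-y, 1:] ^ k * h)"
      by (rule dvd_add[OF g dvd_mult[OF h]])
    then show ?case
      using insert.hyps by (intro exI[of _ h]) (simp add: Q_def algebra_simps)
  qed
  then obtain g where g: "[:q:] dvd f - (\<Prod>x\<in>S. [:-x, 1:] ^ k) * g" by blast
  define Q where "Q = (\<Prod>x\<in>S. [:-x, 1:] ^ k)"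
  \<comment> \<open>Reducing the coefficients makes the leading coefficient of the cofactor nonzero
    modulo q, so the top coefficient of \<open>Q * g1\<close> survives in f.\<close>
  define g1 where "g1 = map_poly (\<lambda>c. c mod q) g"
  have coeff_g1: "coeff g1 i = coeff g i mod q" for i
    by (simp add: g1_def coeff_map_poly)
  have "[:q:] dvd g - g1"
    by (simp add: const_poly_dvd_iff coeff_g1)
  then have "[:q:] dvd (f - Q * g) + Q * (g - g1)"
    using dvd_add[OF g dvd_mult] unfolding Q_def by blast
  then have fg1: "[:q:] dvd f - Q * g1" by (simp add: algebra_simps)
  with nz have "g1 \<noteq> 0" by auto
  have lc: "\<not> q dvd lead_coeff g1"
  proof
    assume "q dvd lead_coeff g1"
    then have "lead_coeff g1 = 0" using coeff_g1[of "degree g1"] by (metis dvd_imp_mod_0 mod_mod_trivial)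
    then show False using \<open>g1 \<noteq> 0\<close> by simp
  qed
  have "lead_coeff Q = 1"
    unfolding Q_def lead_coeff_prod lead_coeff_power by simp
  moreover have "degree Q = k * card S"
    using S unfolding Q_def by (simp add: degree_prod_eq_sum_degree degree_linear_power)
  ultimately have Q: "lead_coeff Q = 1" "degree Q = k * card S" by auto
  have "q dvd coeff (f - Q * g1) (degree (Q * g1))"
    using fg1 by (metis const_poly_dvd_iff)
  moreover have "coeff (Q * g1) (degree (Q * g1)) = lead_coeff g1"
    using Q by (simp add: lead_coeff_mult)
  ultimately have "coeff f (degree (Q * g1)) \<noteq> 0"
    using lc by auto
  then have "degree (Q * g1) \<le> degree f" by (rule le_degree)
  moreover have "degree (Q * g1) = degree Q + degree g1"
    using \<open>g1 \<noteq> 0\<close> Q by (intro degree_mult_eq) auto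
  ultimately show ?thesis using Q by simp
qed

text \<open>A polynomial with n terms vanishes to order at most n - 1 at a nonzero point. Exponents
  below q have differences invertible modulo q, so Y d/dY - e removes one term and no other, and
  induction on the number of terms applies.\<close>

lemma order_mod_less_card_support:
  fixes q x :: int
  assumes q: "prime q" and x: "\<not> q dvd x"
    and small: "\<And>i. \<not> q dvd coeff f i \<Longrightarrow> int i < q"
    and nz: "\<not> [:q:] dvd f"
  shows "\<not> [:q:] dvd f - [:-x, 1:] ^ card {i. \<not> q dvd coeff f i} * g"
  using small nz
proof (induction "card {i. \<not> q dvd coeff f i}" arbitrary: f g rule: less_induct)
  case less
  define supp where "supp = {i. \<not> q dvd coeff f i}"
  have fin: "finite supp"
    by (rule finite_subset[of _ "{..degree f}"]) (auto simp: supp_def intro!: le_degree)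
  obtain e where e: "e \<in> supp"
    using less.prems(2) by (auto simp: supp_def const_poly_dvd_iff)
  define n where "n = card (supp - {e})"
  have n: "card supp = Suc n" using e fin by (metis card_Suc_Diff1 n_def)
  show ?case
  proof
    assume "[:q:] dvd f - [:-x, 1:] ^ card {i. \<not> q dvd coeff f i} * g"
    then have dvd: "[:q:] dvd f - [:-x, 1:] ^ Suc n * g"
      by (simp only: n flip: supp_def)
    \<comment> \<open>\<theta> removes the exponent e from the support and lowers the order at x by at most one.\<close>
    define \<theta> where "\<theta> = (\<lambda>h :: int poly. [:0, 1:] * pderiv h - smult (int e) h)"
    have coeff_\<theta>: "coeff (\<theta> h) i = (int i - int e) * coeff h i" for h i
      by (cases i) (simp_all add: \<theta>_def coeff_pderiv algebra_simps)
    have supp_\<theta>: "{i. \<not> q dvd coeff (\<theta> f) i} = supp - {e}"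
    proof (intro equalityI subsetI)
      fix i assume i: "i \<in> supp - {e}"
      then have "int i < q" "int e < q" using less.prems(1) e by (auto simp: supp_def)
      then have "\<not> q dvd int i - int e"
        using i by (metis Diff_iff insertI1 int_eq_iff mod_eq_dvd_iff mod_pos_pos_trivial of_nat_0_le_iff)
      then show "i \<in> {i. \<not> q dvd coeff (\<theta> f) i}"
        using i q by (auto simp: coeff_\<theta> supp_def prime_dvd_mult_iff)
    qed (auto simp: coeff_\<theta> supp_def)
    show False
    proof (cases "supp - {e} = {}")
      case True
      \<comment> \<open>With one term left, f is a monomial modulo q, and that has no root at the
        unit x.\<close>
      have "[:q:] dvd f - monom (coeff f e) e"
        using True by (auto simp: const_poly_dvd_iff supp_def)
      then have "q dvd poly (f - monom (coeff f e) e) x"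
        by (rule const_poly_dvd_imp_dvd_poly)
      moreover have "q dvd poly (f - [:-x, 1:] ^ Suc n * g) x"
        using dvd by (rule const_poly_dvd_imp_dvd_poly)
      ultimately have "q dvd coeff f e * x ^ e"
        using dvd_diff[of q "poly f x" "poly f x - coeff f e * x ^ e"] by (simp add: poly_monom)
      then show False
        using e x q by (auto simp: supp_def prime_dvd_mult_iff dest: prime_dvd_power)
    next
      case False
      have \<theta>_dvd: "[:q:] dvd \<theta> h" if "[:q:] dvd h" for h
        using that by (simp add: const_poly_dvd_iff coeff_\<theta>)
      have "\<theta> (f - [:-x, 1:] ^ Suc n * g)
          = \<theta> f - [:-x, 1:] ^ n * ([:0, 1:] * (smult (of_nat (Suc n)) g + [:-x, 1:] * pderiv g)
              - smult (int e) ([:-x, 1:] * g))"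
        unfolding \<theta>_def pderiv_diff pderiv_mult pderiv_power_Suc
        by (simp add: algebra_simps pderiv_pCons smult_add_right smult_diff_right)
      with \<theta>_dvd[OF dvd] have "[:q:] dvd \<theta> f - [:-x, 1:] ^ n *
          ([:0, 1:] * (smult (of_nat (Suc n)) g + [:-x, 1:] * pderiv g)
              - smult (int e) ([:-x, 1:] * g))" by simp
      moreover have "card {i. \<not> q dvd coeff (\<theta> f) i} = n"
        by (simp add: supp_\<theta> n_def)
      moreover have "int i < q" if "\<not> q dvd coeff (\<theta> f) i" for i
        using that supp_\<theta> less.prems(1) by (auto simp: supp_def)
      moreover have "\<not> [:q:] dvd \<theta> f"
        using False supp_\<theta> by (auto simp: const_poly_dvd_iff)
      ultimately show False
        using less.hyps[of "\<theta> f"] n by (metis lessI supp_def)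
    qed
  qed
qed


section \<open>Stepanov's method\<close>

text \<open>The derivation Y (Y+1) d/dY. The factor Y (Y+1) clears the denominators in the
  logarithmic derivative of Y^u (Y+1)^v.\<close>

definition euler_op :: "int poly \<Rightarrow> int poly" where
  "euler_op f = [:0, 1, 1:] * pderiv f"

lemma funpow_euler_op_add:
  "(euler_op ^^ m) (f + g) = (euler_op ^^ m) f + (euler_op ^^ m) g"
  by (induction m) (simp_all add: euler_op_def pderiv_add distrib_left del: mult_pCons_left)

lemma funpow_euler_op_smult:
  "(euler_op ^^ m) (smult c f) = smult c ((euler_op ^^ m) f)"
  by (induction m) (simp_all add: euler_op_def pderiv_smult del: mult_pCons_left)

lemma funpow_euler_op_diff:
  "(euler_op ^^ m) (f - g) = (euler_op ^^ m) f - (euler_op ^^ m) g"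
  using funpow_euler_op_add[of m f "smult (-1) g"] funpow_euler_op_smult[of m "-1" g] by simp

lemma funpow_euler_op_sum:
  "(euler_op ^^ m) (\<Sum>i\<in>I. f i) = (\<Sum>i\<in>I. (euler_op ^^ m) (f i))"
proof (induction I rule: infinite_finite_induct)
  case empty
  show ?case using funpow_euler_op_smult[of m 0 0] by simp
next
  case (infinite I)
  then show ?case using funpow_euler_op_smult[of m 0 0] by simp
qed (simp add: funpow_euler_op_add)

lemma const_poly_dvd_funpow_euler_op:
  assumes "[:q:] dvd f"
  shows "[:q:] dvd (euler_op ^^ m) f"
proof -
  obtain g where "f = smult q g" using assms by (auto elim: dvdE)
  then have "(euler_op ^^ m) f = [:q:] * (euler_op ^^ m) g"
    by (simp add: funpow_euler_op_smult)
  then show ?thesis by (metis dvd_triv_left)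
qed

text \<open>At x only the term in which every one of the k derivatives falls on a factor Y - x
  survives.\<close>

lemma poly_funpow_euler_op_linear_power:
  "poly ((euler_op ^^ k) ([:-x, 1:] ^ k * g)) x = fact k * (x * (x + 1)) ^ k * poly g x"
proof (induction k arbitrary: g)
  case (Suc k)
  have "euler_op ([:-x, 1:] ^ Suc k * g)
      = [:-x, 1:] ^ k * (smult (of_nat (Suc k)) ([:0, 1, 1:] * g) + [:-x, 1:] * euler_op g)"
    unfolding euler_op_def pderiv_mult pderiv_power_Suc
    by (simp add: algebra_simps pderiv_pCons smult_add_right)
  then have "poly ((euler_op ^^ Suc k) ([:-x, 1:] ^ Suc k * g)) x
      = fact k * (x * (x + 1)) ^ k *
        poly (smult (of_nat (Suc k)) ([:0, 1, 1:] * g) + [:-x, 1:] * euler_op g) x"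
    unfolding funpow_Suc_right o_def using Suc.IH by simp
  also have "\<dots> = fact (Suc k) * (x * (x + 1)) ^ Suc k * poly g x"
    by (simp add: algebra_simps)
  finally show ?case .
qed simp

text \<open>Each step reads off one more Taylor-type coefficient: D! is invertible because D < p at
  that stage, and x (x+1) because x is neither 0 nor -1 modulo p.\<close>

lemma order_mod_ge_if_euler_op_vanishes:
  fixes p :: nat and x :: int
  assumes p: "prime p" and x: "\<not> int p dvd x" "\<not> int p dvd x + 1"
    and "D \<le> p" and "\<And>m. m < D \<Longrightarrow> int p dvd poly ((euler_op ^^ m) f) x"
  shows "\<exists>g. [:int p:] dvd f - [:-x, 1:] ^ D * g"
  using assms(4,5)
proof (induction D)
  case 0
  show ?case by (auto intro: exI[of _ f])
next
  case (Suc D)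
  then obtain g where g: "[:int p:] dvd f - [:-x, 1:] ^ D * g" by auto
  have q: "prime (int p)" using p by simp
  have "int p dvd poly ((euler_op ^^ D) (f - [:-x, 1:] ^ D * g)) x"
    using g by (intro const_poly_dvd_imp_dvd_poly const_poly_dvd_funpow_euler_op)
  moreover have "int p dvd poly ((euler_op ^^ D) f) x"
    using Suc.prems(2) by simp
  ultimately have "int p dvd fact D * (x * (x + 1)) ^ D * poly g x"
    unfolding funpow_euler_op_diff poly_diff poly_funpow_euler_op_linear_power
    by (simp add: dvd_diff_right_iff)
  moreover have "\<not> int p dvd fact D"
  proof -
    have "\<not> p dvd fact D" using p Suc.prems(1) by (simp add: prime_dvd_fact_iff)
    then show ?thesis by (metis of_nat_dvd_iff of_nat_fact)
  qed
  moreover have "\<not> int p dvd (x * (x + 1)) ^ D"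
    using q x prime_dvd_power prime_dvd_mult_iff by blast
  ultimately have "int p dvd poly g x" using q by (simp add: prime_dvd_mult_iff)
  then obtain h where "[:int p:] dvd g - [:-x, 1:] * h" using factor_root_mod by blast
  then have "[:int p:] dvd (f - [:-x, 1:] ^ D * g) + [:-x, 1:] ^ D * (g - [:-x, 1:] * h)"
    by (rule dvd_add[OF g dvd_mult])
  then show ?case by (intro exI[of _ h]) (simp add: algebra_simps)
qed

text \<open>Conjugating by Y^u (Y+1)^v keeps the degree growth per step at one, however large u and v are;
  this is what makes the linear system for the auxiliary polynomial small.\<close>

definition twisted_euler_op :: "int \<Rightarrow> int \<Rightarrow> int poly \<Rightarrow> int poly" where
  "twisted_euler_op u v f = [:0, 1, 1:] * pderiv f + [:u, u + v:] * f"

text \<open>The linear factor in \<open>twisted_euler_op\<close> is u (Y+1) + v Y, which is Y (Y+1)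
  times the logarithmic derivative of Y^u (Y+1)^v.\<close>

lemma funpow_euler_op_twist:
  "(euler_op ^^ m) (f * ([:0, 1:] ^ u * [:1, 1:] ^ v))
     = (twisted_euler_op (int u) (int v) ^^ m) f * ([:0, 1:] ^ u * [:1, 1:] ^ v)"
proof (induction m)
  case (Suc m)
  define g where "g = (twisted_euler_op (int u) (int v) ^^ m) f"
  have 1: "[:0, 1:] * pderiv ([:0, 1:] ^ u) = smult (int u) ([:0, 1:] ^ u)"
    by (cases u) (simp_all add: pderiv_power_Suc pderiv_pCons del: power_Suc, simp)
  have 2: "[:1, 1:] * pderiv ([:1, 1:] ^ v) = smult (int v) ([:1, 1:] ^ v)"
    by (cases v) (simp_all add: pderiv_power_Suc pderiv_pCons del: power_Suc, simp)
  have "euler_op (g * ([:0, 1:] ^ u * [:1, 1:] ^ v))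
      = [:0, 1, 1:] * pderiv g * ([:0, 1:] ^ u * [:1, 1:] ^ v)
        + g * [:1, 1:] * ([:0, 1:] * pderiv ([:0, 1:] ^ u)) * [:1, 1:] ^ v
        + g * [:0, 1:] * ([:1, 1:] * pderiv ([:1, 1:] ^ v)) * [:0, 1:] ^ u"
  proof -
    have X: "[:0, 1, 1:] = [:0, 1:] * [:1, 1:: int:]" by simp
    have "(x * y) * (g * (a * b' + b * a') + a * b * g')
        = (x * y) * g' * (a * b) + g * y * (x * a') * b + g * x * (y * b') * a"
      for x y g g' a a' b b' :: "int poly" by (simp add: algebra_simps)
    then show ?thesis unfolding euler_op_def pderiv_mult X .
  qed
  also have "\<dots> = twisted_euler_op (int u) (int v) g * ([:0, 1:] ^ u * [:1, 1:] ^ v)"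
  proof -
    have "[:int u, int u + int v:] = smult (int u) [:1, 1:] + smult (int v) [:0, 1:]" by simp
    then show ?thesis
      unfolding 1 2 twisted_euler_op_def 
      by (simp add: algebra_simps smult_add_right smult_add_left)
  qed
  finally show ?case using Suc by (simp add: g_def)
qed simp

lemma degree_funpow_twisted_euler_op_le:
  "degree ((twisted_euler_op u v ^^ m) f) \<le> degree f + m"
proof (induction m)
  case (Suc m)
  define g where "g = (twisted_euler_op u v ^^ m) f"
  have "degree ([:0, 1, 1:] * pderiv g) \<le> degree g + 1"
  proof (cases "degree g = 0")
    case True
    then show ?thesis by (metis degree_0 le0 mult_zero_right pderiv_eq_0_iff)
  next
    case False
    have "degree ([:0, 1, 1:] * pderiv g) \<le> 2 + degree (pderiv g)"
      using degree_mult_le[of "[:0, 1, 1:]" "pderiv g"] by simp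
    then show ?thesis using False by (simp add: degree_pderiv)
  qed
  moreover have "degree ([:u, u + v:] * g) \<le> degree g + 1"
    using degree_mult_le[of "[:u, u + v:]" g] by (auto split: if_splits)
  ultimately have "degree (twisted_euler_op u v g) \<le> degree g + 1"
    unfolding twisted_euler_op_def by (rule degree_add_le)
  then show ?case using Suc by (simp add: g_def)
qed simp


text \<open>The products Y^a Y^(tc) (Y+1)^(tb) are independent modulo p by the bound for sparse
  polynomials at -1: \<open>A * B \<le> t\<close> says that \<open>G b\<close> has no more terms
  than the power of Y+1 dividing it, and \<open>t * B \<le> p\<close> keeps the exponents below
  p.\<close>

lemma stepanov_poly_nonzero_mod:
  fixes p t A B :: nat and w :: "nat \<times> nat \<times> nat \<Rightarrow> int"
  assumes p: "prime p" and AB: "A * B \<le> t" and tB: "t * B \<le> p"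
    and w: "\<exists>i\<in>{..<B} \<times> {..<A} \<times> {..<B}. \<not> int p dvd w i"
  shows "\<not> [:int p:] dvd (\<Sum>(b, a, c)\<in>{..<B} \<times> {..<A} \<times> {..<B}.
            smult (w (b, a, c)) ([:0, 1:] ^ a * ([:0, 1:] ^ (t * c) * [:1, 1:] ^ (t * b))))"
proof
  define q where "q = int p"
  have q: "prime q" using p by (simp add: q_def)
  define L :: "int poly" where "L = [:1, 1:]"
  define G where "G b = (\<Sum>(a, c)\<in>{..<A} \<times> {..<B}. monom (w (b, a, c)) (a + t * c))" for b
  define P where "P b \<longleftrightarrow> (\<exists>a<A. \<exists>c<B. \<not> q dvd w (b, a, c))" for b
  assume "[:int p:] dvd (\<Sum>(b, a, c)\<in>{..<B} \<times> {..<A} \<times> {..<B}.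
            smult (w (b, a, c)) ([:0, 1:] ^ a * ([:0, 1:] ^ (t * c) * [:1, 1:] ^ (t * b))))"
  also have "(\<Sum>(b, a, c)\<in>{..<B} \<times> {..<A} \<times> {..<B}.
            smult (w (b, a, c)) ([:0, 1:] ^ a * ([:0, 1:] ^ (t * c) * [:1, 1:] ^ (t * b))))
      = (\<Sum>b<B. G b * L ^ (t * b))"
    by (simp add: G_def L_def sum.cartesian_product[symmetric] sum_distrib_right monom_altdef
        power_add mult.assoc)
  finally have dvd: "[:q:] dvd (\<Sum>b<B. G b * L ^ (t * b))" by (simp add: q_def)
  \<comment> \<open>For the least b with nonzero G b, the sparse polynomial G b is divisible by L ^ t modulo q.\<close>
  define b where "b = (LEAST b. P b)"
  obtain b1 where b1: "P b1" "b1 < B" using w by (auto simp: P_def q_def)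
  have Pb: "P b" unfolding b_def using b1(1) by (rule LeastI)
  have bB: "b < B" using b1 Least_le[of P b1] by (simp add: b_def)
  have low: "[:q:] dvd G b'" if "b' < b" for b'
  proof -
    have "\<not> P b'" using that not_less_Least unfolding b_def by blast
    then show ?thesis unfolding G_def
      by (intro dvd_sum) (auto simp: P_def const_poly_dvd_iff)
  qed
  define H where "H = (\<Sum>b'\<in>{Suc b..<B}. G b' * L ^ (t * (b' - Suc b)))"
  have "{..<B} = {..<b} \<union> insert b {Suc b..<B}" using bB by auto
  moreover have "{..<b} \<inter> insert b {Suc b..<B} = {}" by auto
  ultimately have "(\<Sum>b<B. G b * L ^ (t * b))
      = (\<Sum>b<b. G b * L ^ (t * b)) + (G b * L ^ (t * b) + (\<Sum>b'\<in>{Suc b..<B}. G b' * L ^ (t * b')))"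
    by (simp add: sum.union_disjoint del: Un_insert_right)
  also have "(\<Sum>b'\<in>{Suc b..<B}. G b' * L ^ (t * b')) = L ^ (t * b) * (L ^ t * H)"
    unfolding H_def sum_distrib_left
  proof (intro sum.cong refl)
    fix b' assume "b' \<in> {Suc b..<B}"
    then have "t * b' = t * b + (t + t * (b' - Suc b))"
      by (metis add.assoc add.commute atLeastLessThan_iff le_add_diff_inverse mult_Suc_right distrib_left)
    then show "G b' * L ^ (t * b') = L ^ (t * b) * (L ^ t * (G b' * L ^ (t * (b' - Suc b))))"
      by (simp only: power_add mult_ac)
  qed
  finally have eq: "(\<Sum>b<B. G b * L ^ (t * b)) = (\<Sum>b<b. G b * L ^ (t * b)) + L ^ (t * b) * (G b + L ^ t * H)"
    by (simp add: algebra_simps)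
  moreover have "[:q:] dvd (\<Sum>b<b. G b * L ^ (t * b))"
    using low by (intro dvd_sum dvd_mult2) auto
  ultimately have "[:q:] dvd L ^ (t * b) * (G b + L ^ t * H)"
    using dvd by (simp add: dvd_add_right_iff)
  then have GH: "[:q:] dvd G b + L ^ t * H"
    unfolding L_def using const_poly_dvd_linear_power_mult_iff[OF q] by blast
  define supp where "supp = {i. \<not> q dvd coeff (G b) i}"
  have coeffG: "coeff (G b) n = (\<Sum>(a, c)\<in>{..<A} \<times> {..<B}. if a + t * c = n then w (b, a, c) else 0)" for n
    unfolding G_def coeff_sum by (intro sum.cong) auto
  have supp: "supp \<subseteq> (\<lambda>(a, c). a + t * c) ` ({..<A} \<times> {..<B})"
  proof
    fix n assume "n \<in> supp"
    then have "\<not> q dvd (\<Sum>(a, c)\<in>{..<A} \<times> {..<B}. if a + t * c = n then w (b, a, c) else 0)"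
      by (simp add: supp_def coeffG)
    then have "\<exists>x\<in>{..<A} \<times> {..<B}. fst x + t * snd x = n"
      by (rule contrapos_np) (auto intro!: dvd_sum)
    then show "n \<in> (\<lambda>(a, c). a + t * c) ` ({..<A} \<times> {..<B})" by force
  qed
  have "card supp \<le> card ((\<lambda>(a, c). a + t * c) ` ({..<A} \<times> {..<B}))"
    using supp by (intro card_mono) auto
  also have "\<dots> \<le> card ({..<A} \<times> {..<B})" by (rule card_image_le) auto
  finally have card: "card supp \<le> t" using AB by simp
  have At: "A \<le> t" using order.trans[OF _ AB, of A] bB by simp
  have small: "int i < q" if i: "\<not> q dvd coeff (G b) i" for i
  proof -
    obtain a c where ac: "a < A" "c < B" "i = a + t * c" using i supp by (auto simp: supp_def)
    have "i < t + t * c" using ac At by simp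
    also have "\<dots> = t * Suc c" by simp
    also have "\<dots> \<le> t * B" using ac by (intro mult_le_mono2) simp
    finally show ?thesis using tB by (simp add: q_def)
  qed
  have nz: "\<not> [:q:] dvd G b"
  proof -
    obtain a c where ac: "a < A" "c < B" "\<not> q dvd w (b, a, c)" using Pb by (auto simp: P_def)
    \<comment> \<open>As A \<le> t, the pair (a, c) consists of the remainder and the quotient of a
      + t c by t, so no two terms of \<open>G b\<close> collide.\<close>
    have "coeff (G b) (a + t * c) = (\<Sum>x\<in>{..<A} \<times> {..<B}. if x = (a, c) then w (b, a, c) else 0)"
      unfolding coeffG
    proof (intro sum.cong refl)
      fix x assume "x \<in> {..<A} \<times> {..<B}"
      then obtain a' c' where x: "x = (a', c')" "a' < A" "c' < B" by auto
      then have "(a' + t * c') div t = c'" "(a' + t * c') mod t = a'"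
        "(a + t * c) div t = c" "(a + t * c) mod t = a" using ac At by auto
      then have "a' + t * c' = a + t * c \<longleftrightarrow> (a', c') = (a, c)" by (metis prod.inject)
      then show "(case x of (a', c') \<Rightarrow> if a' + t * c' = a + t * c then w (b, a', c') else 0)
          = (if x = (a, c) then w (b, a, c) else 0)" using x by auto
    qed
    also have "\<dots> = w (b, a, c)" using ac by (simp add: sum.delta)
    finally show ?thesis using ac by (metis const_poly_dvd_iff)
  qed
  \<comment> \<open>At the point -1 the lemma on sparse polynomials forbids order
    \<open>card supp\<close>, while \<open>GH\<close> gives order t, which is at least
    \<open>card supp\<close>.\<close>
  have "\<not> q dvd - 1" using prime_gt_1_int[OF q] by simp
  then have "\<not> [:q:] dvd G b - [:-(-1), 1:] ^ card supp * (- (L ^ (t - card supp) * H))"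
    unfolding supp_def using q small nz by (intro order_mod_less_card_support)
  moreover have "[:-(-1), 1:] ^ card supp * (- (L ^ (t - card supp) * H)) = - (L ^ t * H)"
    using card by (simp add: L_def mult.assoc[symmetric] flip: power_add)
  ultimately have "\<not> [:q:] dvd G b - - (L ^ t * H)" by metis
  then show False using GH by simp
qed

text \<open>There are A B^2 unknown coefficients against 2 A^2 |Z| conditions: one for each order m
  < A, each z in Z and each coefficient j < 2A of an auxiliary polynomial \<open>U\<close>. Hence
  \<open>2 * card Z * A < B\<^sup>2\<close>. The solution yields a polynomial of degree at most A +
  2tB that vanishes to order A at every point of Y.\<close>

lemma stepanov_bound:
  fixes p t A B :: nat and Z Y :: "int set"
  assumes p: "prime p" and B: "2 * card Z * A < B\<^sup>2"
    and AB: "A * B \<le> t" and tB: "t * B \<le> p"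
    and Z: "finite Z" and Y: "Y \<subseteq> {0..<int p}"
    and Yp: "\<And>y. y \<in> Y \<Longrightarrow> \<not> int p dvd y \<and> \<not> int p dvd y + 1"
    and YZ: "\<And>y. y \<in> Y \<Longrightarrow> \<exists>z\<in>Z. int p dvd y ^ t - z \<and> int p dvd (y + 1) ^ t - z"
  shows "A * card Y \<le> A + 2 * t * B"
proof (cases "A = 0")
  case False
  define q where "q = int p"
  have q: "prime q" using p by (simp add: q_def)
  define I where "I = {..<B} \<times> {..<A} \<times> {..<B}"
  define J where "J = {..<A} \<times> Z \<times> {..<2 * A}"
  define V where "V = (\<lambda>(m, b, a, c). (twisted_euler_op (int (t * c)) (int (t * b)) ^^ m) ([:0, 1:] ^ a))"
  define C where "C = (\<lambda>(m, z, j) (b, a, c). z ^ (b + c) * coeff (V (m, b, a, c)) j)"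
  have "card J = A * (2 * card Z * A)" by (simp add: J_def card_cartesian_product)
  also have "\<dots> < A * B\<^sup>2" using B False by simp
  also have "\<dots> = card I" by (simp add: I_def card_cartesian_product power2_eq_square)
  finally have "card J < card I" .
  moreover have finIJ: "finite I" "finite J" using Z by (simp_all add: I_def J_def)
  moreover have "1 < q" using p prime_gt_1_nat by (simp add: q_def)
  ultimately obtain w where w: "\<exists>i\<in>I. \<not> q dvd w i" "\<And>j. j \<in> J \<Longrightarrow> q dvd (\<Sum>i\<in>I. w i * C j i)"
    using nontrivial_solution_mod[OF finIJ] by blast
  define F where "F = (\<Sum>(b, a, c)\<in>I.
            smult (w (b, a, c)) ([:0, 1:] ^ a * ([:0, 1:] ^ (t * c) * [:1, 1:] ^ (t * b))))"
  have Fnz: "\<not> [:q:] dvd F"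
    unfolding F_def I_def q_def
    by (rule stepanov_poly_nonzero_mod[OF p AB tB]) (use w in \<open>auto simp: I_def q_def\<close>)
  have van: "q dvd poly ((euler_op ^^ m) F) y" if y: "y \<in> Y" and m: "m < A" for y m
  proof -
    obtain z where z: "z \<in> Z" "q dvd y ^ t - z" "q dvd (y + 1) ^ t - z"
      using YZ[OF y] by (auto simp: q_def)
    \<comment> \<open>\<open>U\<close> comes from the m-th derivative by replacing y^t and (y+1)^t
      with z. All its coefficients vanish modulo q: those below 2A by the choice of
      \<open>w\<close>, the others because \<open>V\<close> has degree at most a + m < 2A.\<close>
    define U where "U = (\<Sum>(b, a, c)\<in>I. smult (w (b, a, c) * z ^ (b + c)) (V (m, b, a, c)))"
    have V: "poly ((euler_op ^^ m) ([:0, 1:] ^ a * ([:0, 1:] ^ (t * c) * [:1, 1:] ^ (t * b)))) y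
        = poly (V (m, b, a, c)) y * ((y ^ t) ^ c * ((y + 1) ^ t) ^ b)" for a b c
      unfolding funpow_euler_op_twist by (simp add: V_def power_mult add.commute)
    have "poly ((euler_op ^^ m) F) y
        = (\<Sum>(b, a, c)\<in>I. w (b, a, c) * (poly (V (m, b, a, c)) y * ((y ^ t) ^ c * ((y + 1) ^ t) ^ b)))"
      unfolding F_def funpow_euler_op_sum poly_sum
      by (intro sum.cong refl) (clarify, simp only: funpow_euler_op_smult poly_smult V)
    also have "q dvd \<dots> - poly U y"
    proof -
      have cong: "q dvd (y ^ t) ^ c * ((y + 1) ^ t) ^ b - z ^ (b + c)" for b c
      proof -
        have "((y ^ t) ^ c * ((y + 1) ^ t) ^ b) mod q = (z ^ c * z ^ b) mod q"
          using z(2,3) by (metis mod_eq_dvd_iff mod_mult_cong power_mod)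
        then show ?thesis by (simp add: mod_eq_dvd_iff power_add mult.commute)
      qed
      have "(\<Sum>(b, a, c)\<in>I. w (b, a, c) * (poly (V (m, b, a, c)) y * ((y ^ t) ^ c * ((y + 1) ^ t) ^ b))) - poly U y
          = (\<Sum>(b, a, c)\<in>I. w (b, a, c) * poly (V (m, b, a, c)) y *
               ((y ^ t) ^ c * ((y + 1) ^ t) ^ b - z ^ (b + c)))"
        by (simp add: U_def poly_sum case_prod_unfold sum_subtractf[symmetric] algebra_simps)
      also have "q dvd \<dots>" using cong by (intro dvd_sum) (auto intro: dvd_mult)
      finally show ?thesis .
    qed
    finally have 1: "q dvd poly ((euler_op ^^ m) F) y - poly U y" .
    have "[:q:] dvd U"
    proof -
      have "q dvd coeff U j" for j
      proof (cases "j < 2 * A")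
        case True
        then have "q dvd (\<Sum>i\<in>I. w i * C (m, z, j) i)"
          using w(2)[of "(m, z, j)"] z(1) m by (simp add: J_def)
        then show ?thesis
          by (simp add: U_def coeff_sum C_def case_prod_unfold mult.assoc)
      next
        case False
        have "coeff (V (m, b, a, c)) j = 0" if "a < A" for a b c
        proof (rule coeff_eq_0)
          have "degree (V (m, b, a, c)) \<le> a + m"
            using degree_funpow_twisted_euler_op_le[of m "int (t * c)" "int (t * b)" "[:0, 1:] ^ a"]
            by (simp add: V_def degree_linear_power)
          then show "degree (V (m, b, a, c)) < j" using that m False by simp
        qed
        then have "coeff U j = 0" unfolding U_def coeff_sum by (intro sum.neutral) (auto simp: I_def)
        then show ?thesis by simp
      qed
      then show ?thesis by (simp add: const_poly_dvd_iff)
    qed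
    then have "q dvd poly U y" by (rule const_poly_dvd_imp_dvd_poly)
    with 1 show ?thesis by (simp add: dvd_diff_left_iff)
  qed
  \<comment> \<open>The passage from derivatives to order A requires A \<le> p; here A \<le> t \<le>
    p because B is positive.\<close>
  have "B \<noteq> 0" using B by (intro notI) simp
  then have "A \<le> p" using order.trans[OF _ AB, of A] order.trans[OF _ tB, of t] by simp
  have "A * card Y \<le> degree F"
  proof (rule card_mult_roots_mod_le_degree[OF q])
    show "finite Y" using Y finite_subset by blast
    show "\<not> q dvd x - y" if "x \<in> Y" "y \<in> Y" "x \<noteq> y" for x y
      using that Y unfolding q_def by (metis atLeastLessThan_iff mod_eq_dvd_iff mod_pos_pos_trivial subsetD)
    show "\<exists>g. [:q:] dvd F - [:-y, 1:] ^ A * g" if "y \<in> Y" for y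
      unfolding q_def using Yp[OF that] van[OF that] \<open>A \<le> p\<close>
      by (intro order_mod_ge_if_euler_op_vanishes[OF p]) (auto simp: q_def)
  qed (rule Fnz)
  also have "degree F \<le> A + 2 * t * B"
    unfolding F_def
  proof (intro degree_sum_le)
    show "finite I" by (simp add: I_def)
    fix i assume "i \<in> I"
    then obtain b a c where i: "i = (b, a, c)" "b < B" "a < A" "c < B" by (auto simp: I_def)
    have "degree (smult (w (b, a, c)) ([:0, 1:] ^ a * ([:0, 1:] ^ (t * c) * [:1, 1:] ^ (t * b)))) \<le> a + (t * c + t * b)"
      by (intro order.trans[OF degree_smult_le] order.trans[OF degree_mult_le] add_mono)
        (simp_all add: degree_linear_power)
    also have "\<dots> \<le> A + (t * B + t * B)"
      using i by (intro add_mono mult_le_mono2) auto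
    finally show "degree (case i of (b, a, c) \<Rightarrow> smult (w (b, a, c)) ([:0, 1:] ^ a * ([:0, 1:] ^ (t * c) * [:1, 1:] ^ (t * b)))) \<le> A + 2 * t * B"
      by (simp add: i)
  qed
  finally show ?thesis .
qed simp

section \<open>Additive characters\<close>

definition add_char :: "nat \<Rightarrow> int \<Rightarrow> complex" where
  "add_char p k = cis (2 * pi * real_of_int k / real p)"

lemma add_char_0 [simp]: "add_char p 0 = 1"
  by (simp add: add_char_def)

lemma add_char_add: "add_char p (a + b) = add_char p a * add_char p b"
  by (simp add: add_char_def cis_mult add_divide_distrib distrib_left)

lemma add_char_diff: "add_char p (a - b) = add_char p a * add_char p (- b)"
  using add_char_add[of p a "- b"] by simp

lemma cnj_add_char: "cnj (add_char p k) = add_char p (- k)"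
  by (simp add: add_char_def cis_cnj)

lemma add_char_power: "add_char p k ^ n = add_char p (int n * k)"
  by (simp add: add_char_def DeMoivre mult_ac)

lemma add_char_multiple:
  assumes "p > 0"
  shows "add_char p (int p * k) = 1"
  using assms cis_multiple_2pi[of "real_of_int k"] by (simp add: add_char_def mult.assoc)

lemma add_char_mod:
  assumes "p > 0"
  shows "add_char p (k mod int p) = add_char p k"
proof -
  have "add_char p k = add_char p (int p * (k div int p) + k mod int p)" by simp
  also have "\<dots> = add_char p (k mod int p)"
    unfolding add_char_add using add_char_multiple[OF assms] by simp
  finally show ?thesis by simp
qed

lemma add_char_cong:
  assumes "p > 0" "[a = b] (mod int p)"
  shows "add_char p a = add_char p b"
  using assms add_char_mod[OF assms(1)] by (metis cong_def)

lemma add_char_eq_1_imp_dvd: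
  assumes "p > 0" "add_char p k = 1"
  shows "int p dvd k"
proof -
  have "cos (2 * pi * real_of_int k / real p) = 1"
    using assms(2) by (simp add: add_char_def cis.ctr complex_eq_iff)
  then obtain n :: int where "2 * pi * real_of_int k / real p = of_int n * 2 * pi"
    by (auto simp: cos_one_2pi_int)
  then have "real_of_int k = real_of_int (n * int p)"
    using assms(1) by (simp add: field_simps)
  then have "k = n * int p" using of_int_eq_iff by blast
  then show ?thesis by simp
qed

lemma sum_add_char:
  assumes "p > 0"
  shows "(\<Sum>\<xi><p. add_char p (int \<xi> * k)) = (if int p dvd k then of_nat p else 0)"
proof (cases "int p dvd k")
  case True
  then have "add_char p (int \<xi> * k) = 1" for \<xi>
    using add_char_multiple[OF assms] by (metis dvdE mult.left_commute)
  then show ?thesis using True by simp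
next
  case False
  then have ne: "add_char p k \<noteq> 1" using add_char_eq_1_imp_dvd[OF assms] by blast
  have "(\<Sum>\<xi><p. add_char p (int \<xi> * k)) = (\<Sum>\<xi><p. add_char p k ^ \<xi>)"
    by (simp add: add_char_power)
  also have "\<dots> = (add_char p k ^ p - 1) / (add_char p k - 1)"
    using ne by (rule geometric_sum)
  also have "add_char p k ^ p = 1"
    using add_char_multiple[OF assms] by (simp add: add_char_power)
  finally show ?thesis using False by simp
qed

lemma parseval_mod:
  fixes f :: "nat \<Rightarrow> complex"
  assumes "p > 0"
  shows "(\<Sum>\<xi><p. (norm (\<Sum>x<p. f x * add_char p (int \<xi> * int x)))\<^sup>2) = real p * (\<Sum>x<p. (norm (f x))\<^sup>2)"
proof -
  have "complex_of_real (\<Sum>\<xi><p. (norm (\<Sum>x<p. f x * add_char p (int \<xi> * int x)))\<^sup>2)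
      = (\<Sum>\<xi><p. (\<Sum>x<p. f x * add_char p (int \<xi> * int x)) * cnj (\<Sum>x<p. f x * add_char p (int \<xi> * int x)))"
    by (simp only: of_real_sum complex_norm_square)
  also have "\<dots> = (\<Sum>\<xi><p. \<Sum>x<p. \<Sum>y<p. f x * cnj (f y) * add_char p (int \<xi> * (int x - int y)))"
    by (simp add: sum_product cnj_add_char right_diff_distrib add_char_diff mult_ac)
  also have "\<dots> = (\<Sum>x<p. \<Sum>\<xi><p. \<Sum>y<p. f x * cnj (f y) * add_char p (int \<xi> * (int x - int y)))"
    by (rule sum.swap)
  also have "\<dots> = (\<Sum>x<p. \<Sum>y<p. \<Sum>\<xi><p. f x * cnj (f y) * add_char p (int \<xi> * (int x - int y)))"
    by (intro sum.cong refl sum.swap)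
  also have "\<dots> = (\<Sum>x<p. \<Sum>y<p. if y = x then f x * cnj (f x) * of_nat p else 0)"
  proof (intro sum.cong refl)
    fix x y assume "x \<in> {..<p}" "y \<in> {..<p}"
    then have "int p dvd int x - int y \<longleftrightarrow> y = x"
      by (auto simp: mod_eq_dvd_iff[symmetric])
    then show "(\<Sum>\<xi><p. f x * cnj (f y) * add_char p (int \<xi> * (int x - int y)))
        = (if y = x then f x * cnj (f x) * of_nat p else 0)"
      by (simp add: sum_distrib_left[symmetric] sum_add_char[OF assms])
  qed
  also have "\<dots> = complex_of_real (real p * (\<Sum>x<p. (norm (f x))\<^sup>2))"
    by (simp add: of_real_sum complex_norm_square sum_distrib_left mult_ac del: of_real_power)
  finally show ?thesis using of_real_eq_iff by blast
qed

text \<open>AM-GM with weights k/(k+1) and 1/(k+1), in place of Hoelder's inequality for a moment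
  that mixes two arguments of S. The induction step adds (x^(k+1) - y^(k+1)) (x - y) \<ge>
  0.\<close>

lemma weighted_am_gm:
  fixes x y :: real
  assumes "0 \<le> x" "0 \<le> y"
  shows "real (Suc k) * (x ^ k * y) \<le> real k * x ^ Suc k + y ^ Suc k"
proof (induction k)
  case (Suc k)
  have "0 \<le> (x ^ Suc k - y ^ Suc k) * (x - y)"
  proof (cases "x \<le> y")
    case True
    then show ?thesis using assms by (intro mult_nonpos_nonpos) (auto intro!: mult_mono power_mono)
  next
    case False
    then show ?thesis using assms by (intro mult_nonneg_nonneg) (auto intro!: mult_mono power_mono)
  qed
  moreover have "x * (real (Suc k) * (x ^ k * y)) \<le> x * (real k * x ^ Suc k + y ^ Suc k)"
    using Suc assms by (intro mult_left_mono)
  ultimately show ?case by (simp add: algebra_simps)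
qed simp

section \<open>The Fourier transform of a multiplicative subgroup\<close>

locale prime_subgroup =
  fixes p :: nat and R :: "nat set"
  assumes prime_p: "prime p" and subgroup: "mult_subgroup p R"
begin

lemma p_pos: "0 < p"
  using prime_p prime_gt_0_nat by blast

lemma R_subset: "R \<subseteq> {1..<p}" and one_in_R: "1 \<in> R"
  and R_mult: "x \<in> R \<Longrightarrow> y \<in> R \<Longrightarrow> (x * y) mod p \<in> R"
  and R_inverse: "x \<in> R \<Longrightarrow> \<exists>y\<in>R. (x * y) mod p = 1"
  using subgroup by (auto simp: mult_subgroup_def)

lemma finite_R: "finite R"
  using R_subset finite_subset by blast

lemma card_R_pos: "0 < card R"
  using one_in_R finite_R by (auto simp: card_gt_0_iff)

lemma card_R_less: "card R < p"
proof -
  have "card R \<le> card {1..<p}" using R_subset by (intro card_mono) auto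
  then show ?thesis using p_pos by simp
qed

lemma coprime_p:
  assumes "a \<in> {1..<p}"
  shows "coprime a p"
proof -
  have "\<not> p dvd a" using assms by (auto dest: dvd_imp_le)
  then show ?thesis using prime_imp_coprime[OF prime_p] by (simp add: coprime_commute)
qed

lemma coprime_R: "r \<in> R \<Longrightarrow> coprime r p"
  using coprime_p R_subset by blast

lemma mult_mod_inj:
  assumes "coprime a p"
  shows "inj_on (\<lambda>x. (a * x) mod p) {..<p}"
proof (rule inj_onI)
  fix x y assume xy: "x \<in> {..<p}" "y \<in> {..<p}" "(a * x) mod p = (a * y) mod p"
  then have "[a * x = a * y] (mod p)" by (simp add: cong_def)
  then have "[x = y] (mod p)" using assms by (simp add: cong_mult_lcancel_nat)
  then show "x = y" using xy by (simp add: cong_def)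
qed

lemma mult_mod_bij_R:
  assumes "r \<in> R"
  shows "bij_betw (\<lambda>x. (r * x) mod p) R R"
proof -
  have inj: "inj_on (\<lambda>x. (r * x) mod p) R"
    by (rule inj_on_subset[OF mult_mod_inj[OF coprime_R[OF assms]]]) (use R_subset in auto)
  moreover have "(\<lambda>x. (r * x) mod p) ` R \<subseteq> R" using R_mult assms by auto
  ultimately show ?thesis
    using endo_inj_surj[OF finite_R] by (simp add: bij_betw_def)
qed

lemma mult_mod_bij_units:
  assumes "a \<in> {1..<p}"
  shows "bij_betw (\<lambda>x. (a * x) mod p) {1..<p} {1..<p}"
proof -
  have inj: "inj_on (\<lambda>x. (a * x) mod p) {1..<p}"
    using mult_mod_inj[OF coprime_p[OF assms]] by (auto intro: inj_on_subset)
  moreover have "(\<lambda>x. (a * x) mod p) ` {1..<p} \<subseteq> {1..<p}"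
  proof clarify
    fix x assume x: "x \<in> {1..<p}"
    have "\<not> p dvd a" "\<not> p dvd x" using assms x by (auto dest: dvd_imp_le)
    then have "\<not> p dvd a * x" using prime_p by (simp add: prime_dvd_mult_iff)
    then show "(a * x) mod p \<in> {1..<p}"
      using p_pos by (simp add: mod_greater_zero_iff_not_dvd Suc_le_eq)
  qed
  ultimately show ?thesis
    using endo_inj_surj[of "{1..<p}"] by (simp add: bij_betw_def)
qed

definition S :: "int \<Rightarrow> complex" where
  "S \<xi> = (\<Sum>r\<in>R. add_char p (\<xi> * int r))"

lemma S_cong:
  assumes "[\<xi> = \<eta>] (mod int p)"
  shows "S \<xi> = S \<eta>"
  unfolding S_def
  by (intro sum.cong refl add_char_cong p_pos cong_mult assms) simp

lemma S_mod: "S (\<xi> mod int p) = S \<xi>"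
  by (rule S_cong) (simp add: cong_def)

lemma S_0: "S 0 = of_nat (card R)"
  by (simp add: S_def)

lemma S_mult_R:
  assumes "r \<in> R"
  shows "S (\<xi> * int r) = S \<xi>"
proof -
  have "S \<xi> = (\<Sum>x\<in>R. add_char p (\<xi> * int ((r * x) mod p)))"
    unfolding S_def by (rule sum.reindex_bij_betw[OF mult_mod_bij_R[OF assms], symmetric])
  also have "\<dots> = (\<Sum>x\<in>R. add_char p (\<xi> * int r * int x))"
    by (intro sum.cong refl add_char_cong p_pos)
      (simp add: cong_def zmod_int mod_mult_right_eq mult.assoc)
  finally show ?thesis by (simp add: S_def)
qed

text \<open>Counts the representations d = r - s with r and s in R; writing s + d avoids truncated
  subtraction on naturals.\<close>

definition diff_rep :: "nat \<Rightarrow> nat" where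
  "diff_rep d = card {s \<in> R. (s + d) mod p \<in> R}"

text \<open>The number of solutions of r1 - s1 = r2 - s2 in R, grouped by the common
  difference.\<close>

definition energy :: nat where
  "energy = (\<Sum>d<p. (diff_rep d)\<^sup>2)"

lemma sum_differences:
  fixes h :: "int \<Rightarrow> complex"
  assumes h: "\<And>k. h (k mod int p) = h k"
  shows "(\<Sum>s\<in>R. \<Sum>r\<in>R. h (int r - int s)) = (\<Sum>d<p. of_nat (diff_rep d) * h (int d))"
proof -
  have "(\<Sum>r\<in>R. h (int r - int s)) = (\<Sum>d<p. if (s + d) mod p \<in> R then h (int d) else 0)"
    if s: "s \<in> R" for s
  proof -
    have "(\<Sum>r\<in>R. h (int r - int s)) = (\<Sum>d\<in>{d. d < p \<and> (s + d) mod p \<in> R}. h (int d))"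
    proof (rule sum.reindex_bij_witness[where j = "\<lambda>r. nat ((int r - int s) mod int p)"
          and i = "\<lambda>d. (s + d) mod p"])
      fix r assume r: "r \<in> R"
      have "int ((s + nat ((int r - int s) mod int p)) mod p) = int r mod int p"
        using p_pos by (simp add: zmod_int mod_add_right_eq)
      also have "\<dots> = int r" using r R_subset by auto
      finally show *: "(s + nat ((int r - int s) mod int p)) mod p = r" by simp
      show "nat ((int r - int s) mod int p) \<in> {d. d < p \<and> (s + d) mod p \<in> R}"
        using * r p_pos by (simp add: nat_less_iff)
      show "h (int (nat ((int r - int s) mod int p))) = h (int r - int s)"
        using p_pos h by simp
    next
      fix d assume d: "d \<in> {d. d < p \<and> (s + d) mod p \<in> R}"
      then show "(s + d) mod p \<in> R" by simp
      have "(int ((s + d) mod p) - int s) mod int p = int d mod int p"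
        by (simp add: zmod_int mod_diff_left_eq)
      also have "\<dots> = int d" using d by simp
      finally show "nat ((int ((s + d) mod p) - int s) mod int p) = d" by simp
    qed
    also have "\<dots> = (\<Sum>d<p. if (s + d) mod p \<in> R then h (int d) else 0)"
      by (subst sum.inter_filter[symmetric]) (auto intro!: sum.cong)
    finally show ?thesis .
  qed
  then have "(\<Sum>s\<in>R. \<Sum>r\<in>R. h (int r - int s))
      = (\<Sum>s\<in>R. \<Sum>d<p. if (s + d) mod p \<in> R then h (int d) else 0)" by simp
  also have "\<dots> = (\<Sum>d<p. \<Sum>s\<in>R. if (s + d) mod p \<in> R then h (int d) else 0)"
    by (rule sum.swap)
  also have "\<dots> = (\<Sum>d<p. of_nat (diff_rep d) * h (int d))"
    by (intro sum.cong refl) (simp add: diff_rep_def sum.inter_filter[symmetric] finite_R)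
  finally show ?thesis .
qed

lemma sum_diff_rep: "(\<Sum>d<p. diff_rep d) = (card R)\<^sup>2"
proof -
  have "of_nat (\<Sum>d<p. diff_rep d) = (of_nat ((card R)\<^sup>2) :: complex)"
    using sum_differences[of "\<lambda>_. 1"] by (simp add: power2_eq_square)
  then show ?thesis by (simp only: of_nat_eq_iff)
qed

lemma norm_S_square:
  "complex_of_real ((norm (S \<xi>))\<^sup>2) = (\<Sum>d<p. of_nat (diff_rep d) * add_char p (\<xi> * int d))"
proof -
  have "complex_of_real ((norm (S \<xi>))\<^sup>2) = cnj (S \<xi>) * S \<xi>"
    by (simp only: complex_norm_square mult.commute)
  also have "\<dots> = (\<Sum>s\<in>R. \<Sum>r\<in>R. add_char p (\<xi> * (int r - int s)))"
    by (simp add: S_def sum_product cnj_add_char add_char_add[symmetric] algebra_simps) (rule sum.swap)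
  also have "\<dots> = (\<Sum>d<p. of_nat (diff_rep d) * add_char p (\<xi> * int d))"
    by (rule sum_differences) (intro add_char_cong p_pos, simp add: cong_def mod_mult_right_eq)
  finally show ?thesis .
qed

lemma sum_norm_S_square: "(\<Sum>\<xi><p. (norm (S (int \<xi>)))\<^sup>2) = real p * real (card R)"
proof -
  have eq: "(\<Sum>x<p. (if x \<in> R then f x else 0)) = (\<Sum>x\<in>R. f x)" for f :: "nat \<Rightarrow> 'a::comm_monoid_add"
    using R_subset by (subst sum.inter_restrict[symmetric]) (auto intro!: sum.cong)
  have "S (int \<xi>) = (\<Sum>x<p. (if x \<in> R then 1 else 0) * add_char p (int \<xi> * int x))" for \<xi>
    unfolding S_def eq[symmetric] by (intro sum.cong) auto
  then have "(\<Sum>\<xi><p. (norm (S (int \<xi>)))\<^sup>2) = real p * (\<Sum>x<p. (norm (if x \<in> R then 1 else 0 :: complex))\<^sup>2)"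
    using parseval_mod[OF p_pos, of "\<lambda>x. if x \<in> R then 1 else 0"] by simp
  also have "(\<Sum>x<p. (norm (if x \<in> R then 1 else 0 :: complex))\<^sup>2) = (\<Sum>x<p. if x \<in> R then 1 else 0)"
    by (intro sum.cong) auto
  also have "\<dots> = real (card R)" unfolding eq by simp
  finally show ?thesis .
qed

text \<open>|S|^2 is the Fourier transform of \<open>diff_rep\<close>, so this is Parseval's
  identity for \<open>diff_rep\<close>.\<close>

lemma sum_norm_S_power4: "(\<Sum>\<xi><p. norm (S (int \<xi>)) ^ 4) = real p * real energy"
proof -
  have "(\<Sum>\<xi><p. norm (S (int \<xi>)) ^ 4) = (\<Sum>\<xi><p. (norm (complex_of_real ((norm (S (int \<xi>)))\<^sup>2)))\<^sup>2)"
    by (intro sum.cong refl) (simp add: norm_power power_mult[symmetric])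
  also have "\<dots> = real p * (\<Sum>d<p. (norm (of_nat (diff_rep d) :: complex))\<^sup>2)"
    unfolding norm_S_square by (rule parseval_mod[OF p_pos])
  also have "\<dots> = real p * real energy" by (simp add: energy_def)
  finally show ?thesis .
qed

lemma card_mult_norm_S_power_le:
  assumes "\<xi> \<in> {1..<p}"
  shows "real (card R) * norm (S (int \<xi>)) ^ k \<le> (\<Sum>\<eta><p. norm (S (int \<eta>)) ^ k)"
proof -
  have S: "S (int ((\<xi> * r) mod p)) = S (int \<xi>)" if "r \<in> R" for r
    using S_mult_R[OF that, of "int \<xi>"] S_mod[of "int \<xi> * int r"] by (simp add: zmod_int)
  have "real (card R) * norm (S (int \<xi>)) ^ k = (\<Sum>r\<in>R. norm (S (int ((\<xi> * r) mod p))) ^ k)"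
    by (simp add: S)
  also have "\<dots> = (\<Sum>\<eta>\<in>(\<lambda>r. (\<xi> * r) mod p) ` R. norm (S (int \<eta>)) ^ k)"
    by (subst sum.reindex[OF inj_on_subset[OF mult_mod_inj[OF coprime_p[OF assms]]]])
      (use R_subset in auto)
  also have "\<dots> \<le> (\<Sum>\<eta><p. norm (S (int \<eta>)) ^ k)"
    using p_pos by (intro sum_mono2) auto
  finally show ?thesis .
qed

lemma norm_S_square_le:
  assumes "\<xi> \<in> {1..<p}"
  shows "(norm (S (int \<xi>)))\<^sup>2 \<le> real p"
  using card_mult_norm_S_power_le[OF assms, of 2] card_R_pos
  by (simp add: sum_norm_S_square mult.commute)

lemma norm_S_power4_le:
  assumes "\<xi> \<in> {1..<p}"
  shows "real (card R) * norm (S (int \<xi>)) ^ 4 \<le> real p * real energy"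
  using card_mult_norm_S_power_le[OF assms, of 4] by (simp add: sum_norm_S_power4)

text \<open>Summing |S(\<xi> u)|^2 over u in R and expanding gives t X^2 = |sum of N(d) S(\<xi> d)|.
  A first Cauchy-Schwarz inequality uses the total mass t^2 of N and cancels t; a second one bounds
  the remaining sum of N f^2 by E and the fourth moment p E.\<close>

lemma norm_S_power8_le:
  assumes "\<xi> \<in> {1..<p}"
  shows "norm (S (int \<xi>)) ^ 8 \<le> real p * (real energy)\<^sup>2"
proof -
  define t where "t = real (card R)"
  have t: "0 < t" using card_R_pos by (simp add: t_def)
  define X where "X = norm (S (int \<xi>))"
  define f where "f d = norm (S (int \<xi> * int d))" for d
  define N where "N d = real (diff_rep d)" for d
  have "complex_of_real (t * X\<^sup>2) = (\<Sum>u\<in>R. complex_of_real ((norm (S (int \<xi> * int u)))\<^sup>2))"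
    using S_mult_R by (simp add: X_def t_def)
  also have "\<dots> = (\<Sum>u\<in>R. \<Sum>d<p. of_nat (diff_rep d) * add_char p (int \<xi> * int u * int d))"
    unfolding norm_S_square ..
  also have "\<dots> = (\<Sum>d<p. of_nat (diff_rep d) * S (int \<xi> * int d))"
    unfolding S_def sum_distrib_left by (subst sum.swap) (simp add: mult_ac)
  finally have "t * X\<^sup>2 = norm (\<Sum>d<p. of_nat (diff_rep d) * S (int \<xi> * int d))"
    using t by (metis abs_of_nonneg mult_nonneg_nonneg norm_of_real order_less_imp_le zero_le_power2)
  also have "\<dots> \<le> (\<Sum>d<p. N d * f d)"
    by (rule order.trans[OF norm_sum]) (simp add: norm_mult N_def f_def)
  finally have "(t * X\<^sup>2)\<^sup>2 \<le> (\<Sum>d<p. N d * f d)\<^sup>2" using t by (intro power_mono) auto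
  also have "\<dots> = (\<Sum>d<p. sqrt (N d) * (sqrt (N d) * f d))\<^sup>2"
    by (simp add: mult.assoc[symmetric] N_def)
  also have "\<dots> \<le> (\<Sum>d<p. (sqrt (N d))\<^sup>2) * (\<Sum>d<p. (sqrt (N d) * f d)\<^sup>2)"
    by (rule Cauchy_Schwarz_ineq_sum)
  also have "\<dots> = (\<Sum>d<p. N d) * (\<Sum>d<p. N d * (f d)\<^sup>2)"
    by (simp add: power_mult_distrib N_def)
  also have "(\<Sum>d<p. N d) = t\<^sup>2"
    using sum_diff_rep by (simp add: N_def t_def flip: of_nat_sum)
  finally have 1: "X ^ 4 \<le> (\<Sum>d<p. N d * (f d)\<^sup>2)"
    using t by (simp add: power_mult_distrib flip: power_mult)
  have "X ^ 8 = (X ^ 4)\<^sup>2" by (simp flip: power_mult)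
  also have "\<dots> \<le> (\<Sum>d<p. N d * (f d)\<^sup>2)\<^sup>2" using 1 by (intro power_mono) (simp_all add: X_def)
  also have "\<dots> \<le> (\<Sum>d<p. (N d)\<^sup>2) * (\<Sum>d<p. ((f d)\<^sup>2)\<^sup>2)" by (rule Cauchy_Schwarz_ineq_sum)
  also have "(\<Sum>d<p. (N d)\<^sup>2) = real energy" by (simp add: N_def energy_def)
  also have "(\<Sum>d<p. ((f d)\<^sup>2)\<^sup>2) = (\<Sum>d<p. norm (S (int ((\<xi> * d) mod p))) ^ 4)"
    using S_mod[of "int \<xi> * int d" for d] by (simp add: f_def zmod_int flip: power_mult)
  also have "\<dots> = (\<Sum>\<eta>\<in>(\<lambda>d. (\<xi> * d) mod p) ` {..<p}. norm (S (int \<eta>)) ^ 4)"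
    by (subst sum.reindex[OF mult_mod_inj[OF coprime_p[OF assms]]]) simp
  also have "(\<lambda>d. (\<xi> * d) mod p) ` {..<p} = {..<p}"
    using p_pos by (intro endo_inj_surj mult_mod_inj coprime_p assms) auto
  finally show ?thesis
    by (simp add: sum_norm_S_power4 X_def power2_eq_square mult_ac)
qed

section \<open>Elements missing from a sumset and moments of S\<close>

lemma sumset_less: "x \<in> sumset_mod p l R \<Longrightarrow> x < p"
  using p_pos prime_gt_1_nat[OF prime_p] by (cases l) auto

lemma finite_sumset: "finite (sumset_mod p l R)"
  using sumset_less by (meson bounded_nat_set_is_finite)

lemma sumset_mult:
  assumes "r \<in> R"
  shows "x \<in> sumset_mod p l R \<Longrightarrow> (x * r) mod p \<in> sumset_mod p l R"
proof (induction l arbitrary: x)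
  case (Suc l)
  then obtain a s where as: "a \<in> sumset_mod p l R" "s \<in> R" "x = (a + s) mod p" by auto
  have "(x * r) mod p = ((a * r) mod p + (s * r) mod p) mod p"
    by (simp add: as(3) mod_mult_left_eq mod_add_eq distrib_right)
  then show ?case using Suc.IH[OF as(1)] R_mult[OF as(2) assms] by auto
qed simp

text \<open>Only the support of the weights matters: orthogonality compares it with a coset that it
  misses, so the weights need not be identified as representation counts.\<close>

lemma S_power_eq_sum_sumset:
  "\<exists>w :: nat \<Rightarrow> complex. \<forall>\<xi>. S \<xi> ^ l = (\<Sum>x\<in>sumset_mod p l R. w x * add_char p (\<xi> * int x))"
proof (induction l)
  case 0
  show ?case by (intro exI[of _ "\<lambda>_. 1"]) simp
next
  case (Suc l)
  then obtain w :: "nat \<Rightarrow> complex" where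
    w: "S \<xi> ^ l = (\<Sum>x\<in>sumset_mod p l R. w x * add_char p (\<xi> * int x))" for \<xi> by blast
  define A where "A = sumset_mod p l R \<times> R"
  define g where "g = (\<lambda>(x, r). (x + r) mod p)"
  have gA: "g ` A \<subseteq> sumset_mod p (Suc l) R" by (auto simp: g_def A_def)
  have finA: "finite A" by (simp add: A_def finite_sumset finite_R)
  show ?case
  proof (intro exI[of _ "\<lambda>z. \<Sum>y\<in>{y\<in>A. g y = z}. w (fst y)"] allI)
    fix \<xi>
    have "S \<xi> ^ Suc l = (\<Sum>x\<in>sumset_mod p l R. w x * add_char p (\<xi> * int x)) * S \<xi>"
      by (simp add: w mult.commute)
    also have "\<dots> = (\<Sum>y\<in>A. w (fst y) * add_char p (\<xi> * int (g y)))"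
      unfolding S_def sum_product A_def sum.cartesian_product
    proof (intro sum.cong refl, clarify)
      fix x r
      have "add_char p (\<xi> * int (g (x, r))) = add_char p (\<xi> * int x + \<xi> * int r)"
        by (intro add_char_cong p_pos) (simp add: g_def cong_def zmod_int mod_mult_right_eq distrib_left)
      then show "w x * add_char p (\<xi> * int x) * add_char p (\<xi> * int r)
          = w (fst (x, r)) * add_char p (\<xi> * int (g (x, r)))"
        by (simp add: add_char_add)
    qed
    also have "\<dots> = (\<Sum>z\<in>sumset_mod p (Suc l) R. \<Sum>y\<in>{y\<in>A. g y = z}. w (fst y) * add_char p (\<xi> * int (g y)))"
      by (rule sum.group[OF finA finite_sumset gA, symmetric])
    also have "\<dots> = (\<Sum>z\<in>sumset_mod p (Suc l) R. (\<Sum>y\<in>{y\<in>A. g y = z}. w (fst y)) * add_char p (\<xi> * int z))"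
      unfolding sum_distrib_right by (intro sum.cong refl) auto
    finally show "S \<xi> ^ Suc l = \<dots>" .
  qed
qed

lemma missing_imp_large_sum:
  assumes a: "a \<in> {1..<p}" "a \<notin> sumset_mod p l R"
  shows "real (card R) ^ Suc l \<le> (\<Sum>\<xi>\<in>{1..<p}. norm (S (int \<xi>)) ^ l * norm (S (int ((a * \<xi>) mod p))))"
proof -
  obtain w :: "nat \<Rightarrow> complex" where
    w: "S \<xi> ^ l = (\<Sum>x\<in>sumset_mod p l R. w x * add_char p (\<xi> * int x))" for \<xi>
    using S_power_eq_sum_sumset by blast
  \<comment> \<open>Expanded, the sum of T over all \<xi> detects solutions of x = a r with x in lR,
    of which there are none; so the term at \<xi> = 0, of size t^(l+1), is cancelled by the
    others.\<close>
  define T where "T \<xi> = S (int \<xi>) ^ l * cnj (S (int a * int \<xi>))" for \<xi> :: nat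
  have "(\<Sum>\<xi><p. T \<xi>) = (\<Sum>\<xi><p. \<Sum>x\<in>sumset_mod p l R. \<Sum>r\<in>R. w x * add_char p (int \<xi> * (int x - int a * int r)))"
    unfolding T_def w unfolding S_def cnj_sum sum_product
    by (simp add: cnj_add_char right_diff_distrib add_char_diff mult_ac)
  also have "\<dots> = (\<Sum>x\<in>sumset_mod p l R. \<Sum>r\<in>R. w x * (\<Sum>\<xi><p. add_char p (int \<xi> * (int x - int a * int r))))"
    unfolding sum_distrib_left
    by (rule trans[OF sum.swap]) (intro sum.cong refl sum.swap)
  also have "\<dots> = 0"
  proof (intro sum.neutral ballI)
    fix x r assume x: "x \<in> sumset_mod p l R" and r: "r \<in> R"
    have "\<not> int p dvd int x - int a * int r"
    proof
      assume "int p dvd int x - int a * int r"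
      then have "[x = a * r] (mod p)" by (metis cong_iff_dvd_diff cong_int_iff of_nat_mult)
      moreover obtain s where s: "s \<in> R" "(r * s) mod p = 1" using R_inverse[OF r] by blast
      ultimately have "[x * s = a * (r * s)] (mod p)"
        by (metis cong_scalar_right mult.assoc)
      moreover have "[a * (r * s) = a * 1] (mod p)"
        using s(2) prime_gt_1_nat[OF prime_p] by (intro cong_scalar_left) (simp add: cong_def)
      ultimately have "(x * s) mod p = a mod p" by (simp add: cong_def)
      then have "a \<in> sumset_mod p l R" using sumset_mult[OF s(1) x] a(1) by simp
      then show False using a(2) by blast
    qed
    then show "w x * (\<Sum>\<xi><p. add_char p (int \<xi> * (int x - int a * int r))) = 0"
      by (simp add: sum_add_char[OF p_pos])
  qed
  finally have "(\<Sum>\<xi><p. T \<xi>) = 0" .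
  moreover have "{..<p} = insert 0 {1..<p}" using p_pos by auto
  ultimately have "T 0 = - (\<Sum>\<xi>\<in>{1..<p}. T \<xi>)" by (simp add: eq_neg_iff_add_eq_0)
  then have "norm (T 0) = norm (\<Sum>\<xi>\<in>{1..<p}. T \<xi>)" by simp
  also have "\<dots> \<le> (\<Sum>\<xi>\<in>{1..<p}. norm (T \<xi>))" by (rule norm_sum)
  also have "\<dots> = (\<Sum>\<xi>\<in>{1..<p}. norm (S (int \<xi>)) ^ l * norm (S (int ((a * \<xi>) mod p))))"
    using S_mod[of "int a * int \<xi>" for \<xi>] by (simp add: T_def norm_mult norm_power zmod_int)
  finally show ?thesis by (simp add: T_def S_0 norm_mult norm_power mult.commute)
qed

text \<open>All but k of the l factors |S(\<xi>)| are bounded by M. In the rest, AM-GM separates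
  \<xi> from a \<xi>, and multiplication by a permutes the nonzero frequencies. The cases k = 1 and
  k = 3 lead to the second and the fourth moment.\<close>

lemma missing_imp_moment_ge:
  assumes a: "a \<in> {1..<p}" "a \<notin> sumset_mod p l R" and k: "k \<le> l"
    and M: "\<And>\<xi>. \<xi> \<in> {1..<p} \<Longrightarrow> norm (S (int \<xi>)) \<le> M"
  shows "real (card R) ^ Suc l \<le> M ^ (l - k) * (\<Sum>\<xi><p. norm (S (int \<xi>)) ^ Suc k)"
proof -
  define f where "f \<xi> = norm (S (int \<xi>))" for \<xi> :: nat
  have f: "0 \<le> f \<xi>" for \<xi> by (simp add: f_def)
  have M0: "0 \<le> M" using M[OF a(1)] norm_ge_zero order.trans by blast
  have "real (card R) ^ Suc l \<le> (\<Sum>\<xi>\<in>{1..<p}. f \<xi> ^ l * f ((a * \<xi>) mod p))"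
    using missing_imp_large_sum[OF a] by (simp add: f_def)
  also have "\<dots> \<le> (\<Sum>\<xi>\<in>{1..<p}. M ^ (l - k) * (f \<xi> ^ k * f ((a * \<xi>) mod p)))"
  proof (intro sum_mono)
    fix \<xi> assume \<xi>: "\<xi> \<in> {1..<p}"
    have "f \<xi> ^ l = f \<xi> ^ (l - k) * f \<xi> ^ k" using k by (simp flip: power_add)
    also have "\<dots> \<le> M ^ (l - k) * f \<xi> ^ k"
      using M[OF \<xi>] f by (intro mult_right_mono power_mono) (auto simp: f_def)
    finally have "f \<xi> ^ l * f ((a * \<xi>) mod p) \<le> M ^ (l - k) * f \<xi> ^ k * f ((a * \<xi>) mod p)"
      using f by (rule mult_right_mono)
    then show "f \<xi> ^ l * f ((a * \<xi>) mod p) \<le> M ^ (l - k) * (f \<xi> ^ k * f ((a * \<xi>) mod p))"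
      by (simp add: mult.assoc)
  qed
  also have "\<dots> = M ^ (l - k) * (\<Sum>\<xi>\<in>{1..<p}. f \<xi> ^ k * f ((a * \<xi>) mod p))"
    by (simp add: sum_distrib_left)
  also have "(\<Sum>\<xi>\<in>{1..<p}. f \<xi> ^ k * f ((a * \<xi>) mod p)) \<le> (\<Sum>\<xi>\<in>{1..<p}. f \<xi> ^ Suc k)"
  proof -
    have "real (Suc k) * (\<Sum>\<xi>\<in>{1..<p}. f \<xi> ^ k * f ((a * \<xi>) mod p))
        \<le> (\<Sum>\<xi>\<in>{1..<p}. real k * f \<xi> ^ Suc k + f ((a * \<xi>) mod p) ^ Suc k)"
      unfolding sum_distrib_left by (intro sum_mono weighted_am_gm f)
    also have "\<dots> = real k * (\<Sum>\<xi>\<in>{1..<p}. f \<xi> ^ Suc k) + (\<Sum>\<xi>\<in>{1..<p}. f ((a * \<xi>) mod p) ^ Suc k)"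
      by (simp add: sum.distrib sum_distrib_left)
    also have "(\<Sum>\<xi>\<in>{1..<p}. f ((a * \<xi>) mod p) ^ Suc k) = (\<Sum>\<xi>\<in>{1..<p}. f \<xi> ^ Suc k)"
      by (rule sum.reindex_bij_betw[OF mult_mod_bij_units[OF a(1)]])
    finally have "real (Suc k) * (\<Sum>\<xi>\<in>{1..<p}. f \<xi> ^ k * f ((a * \<xi>) mod p))
        \<le> real (Suc k) * (\<Sum>\<xi>\<in>{1..<p}. f \<xi> ^ Suc k)"
      by (simp add: algebra_simps)
    then show ?thesis by (rule mult_left_le_imp_le) simp
  qed
  also have "(\<Sum>\<xi>\<in>{1..<p}. f \<xi> ^ Suc k) \<le> (\<Sum>\<xi><p. f \<xi> ^ Suc k)"
    using f by (intro sum_mono2) auto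
  finally show ?thesis using M0 by (simp add: f_def mult_left_mono)
qed

end

section \<open>The additive energy of a multiplicative subgroup\<close>

text \<open>Telescoping, from 1/(T+1)^2 \<le> 1/T - 1/(T+1).\<close>

lemma sum_inverse_squares_le:
  assumes "0 < s" "s \<le> T"
  shows "(\<Sum>\<tau>\<in>{s<..T}. 1 / (real \<tau>)\<^sup>2) \<le> 1 / real s - 1 / real T"
  using assms(2)
proof (induction T rule: dec_induct)
  case (step T)
  have "0 < T" using assms(1) step.hyps by simp
  have "{s<..Suc T} = insert (Suc T) {s<..T}" using step.hyps by auto
  then have "(\<Sum>\<tau>\<in>{s<..Suc T}. 1 / (real \<tau>)\<^sup>2) = 1 / (real (Suc T))\<^sup>2 + (\<Sum>\<tau>\<in>{s<..T}. 1 / (real \<tau>)\<^sup>2)"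
    by simp
  also have "\<dots> \<le> 1 / (real T * real (Suc T)) + (1 / real s - 1 / real T)"
    using step.IH \<open>0 < T\<close> by (intro add_mono divide_left_mono) (auto simp: power2_eq_square)
  also have "\<dots> = 1 / real s - 1 / real (Suc T)"
    using \<open>0 < T\<close> by (simp add: divide_simps) (simp add: algebra_simps)
  finally show ?case .
qed simp

text \<open>Layer decomposition of a square: the part up to s is charged linearly, and each level
  \<tau> above s costs \<tau>^2 - (\<tau>-1)^2 \<le> 2 \<tau>.\<close>

lemma square_le_layers:
  fixes n s :: nat
  shows "n\<^sup>2 \<le> s * n + (\<Sum>\<tau>\<in>{s<..n}. 2 * \<tau>)"
proof (induction n)
  case (Suc n)
  show ?case
  proof (cases "Suc n \<le> s")
    case True
    then show ?thesis using mult_le_mono1[OF True, of "Suc n"] by (simp add: power2_eq_square)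
  next
    case False
    then have "{s<..Suc n} = insert (Suc n) {s<..n}" by auto
    then show ?thesis using Suc by (simp add: power2_eq_square)
  qed
qed simp

lemma powr_divide_power:
  fixes x :: real
  assumes "0 < x" "0 < n"
  shows "(x powr (real m / real n)) ^ n = x ^ m"
proof -
  have "(x powr (real m / real n)) ^ n = x powr (real m / real n * real n)"
    using powr_realpow[of "x powr (real m / real n)" n] assms by (simp add: powr_powr)
  also have "real m / real n * real n = real m" using assms by simp
  finally show ?thesis using assms by (simp only: powr_realpow)
qed

context prime_subgroup
begin

text \<open>Fermat's argument: multiplication by r permutes R, so the product over R is multiplied
  by r^|R| and stays the same.\<close>

lemma power_card_R:
  assumes "r \<in> R"
  shows "[r ^ card R = 1] (mod p)"
proof -
  have "[\<Prod>x\<in>R. x = (\<Prod>x\<in>R. r * x)] (mod p)"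
  proof -
    have "(\<Prod>x\<in>R. x) = (\<Prod>x\<in>R. (r * x) mod p)"
      by (rule prod.reindex_bij_betw[OF mult_mod_bij_R[OF assms], symmetric])
    also have "[\<dots> = (\<Prod>x\<in>R. r * x)] (mod p)"
      by (rule cong_prod) (simp add: cong_def)
    finally show ?thesis .
  qed
  then have "[r ^ card R * (\<Prod>x\<in>R. x) = 1 * (\<Prod>x\<in>R. x)] (mod p)"
    by (simp add: prod.distrib cong_sym_eq)
  moreover have "coprime (\<Prod>x\<in>R. x) p" by (rule prod_coprime_left) (rule coprime_R)
  ultimately show ?thesis using cong_mult_rcancel_nat by blast
qed

lemma unit_inverse:
  obtains iv where "\<And>d. d \<in> {1..<p} \<Longrightarrow> iv d \<in> {1..<p} \<and> [d * iv d = 1] (mod p)"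
proof -
  have "\<exists>e. e \<in> {1..<p} \<and> [d * e = 1] (mod p)" if d: "d \<in> {1..<p}" for d
  proof -
    have "1 \<in> (\<lambda>x. (d * x) mod p) ` {1..<p}"
      using mult_mod_bij_units[OF d] prime_gt_1_nat[OF prime_p] by (simp add: bij_betw_def)
    then show ?thesis using prime_gt_1_nat[OF prime_p] by (auto simp: cong_def)
  qed
  then show thesis using that by metis
qed

text \<open>d = 0 is left out: it has |R| representations and no inverse, and its share of the
  energy is added separately.\<close>

definition rich :: "nat \<Rightarrow> nat set" where
  "rich \<tau> = {d \<in> {1..<p}. \<tau> \<le> diff_rep d}"

lemma finite_rich [simp]: "finite (rich \<tau>)"
  by (simp add: rich_def)

lemma diff_rep_mult_le:
  assumes "r \<in> R"
  shows "diff_rep d \<le> diff_rep ((d * r) mod p)"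
  unfolding diff_rep_def
proof (rule card_inj_on_le)
  show "inj_on (\<lambda>s. (r * s) mod p) {s \<in> R. (s + d) mod p \<in> R}"
    by (rule inj_on_subset[OF mult_mod_inj[OF coprime_R[OF assms]]]) (use R_subset in auto)
  show "(\<lambda>s. (r * s) mod p) ` {s \<in> R. (s + d) mod p \<in> R}
      \<subseteq> {s \<in> R. (s + (d * r) mod p) mod p \<in> R}"
  proof clarify
    fix s assume s: "s \<in> R" "(s + d) mod p \<in> R"
    have "((r * s) mod p + (d * r) mod p) mod p = (r * ((s + d) mod p)) mod p"
      by (simp add: mod_add_eq mod_mult_right_eq distrib_left mult.commute)
    then show "(r * s) mod p \<in> R \<and> ((r * s) mod p + (d * r) mod p) mod p \<in> R"
      using s assms R_mult by simp
  qed
qed (use finite_R in simp)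

text \<open>So \<open>rich \<tau>\<close> is a union of cosets of R, and the |R| elements of a coset
  share one value d^(-t).\<close>

lemma rich_mult:
  assumes "r \<in> R" "d \<in> rich \<tau>"
  shows "(d * r) mod p \<in> rich \<tau>"
proof -
  have d: "d \<in> {1..<p}" "\<tau> \<le> diff_rep d" using assms(2) by (auto simp: rich_def)
  have "(d * r) mod p \<in> {1..<p}"
    using mult_mod_bij_units[OF d(1)] assms(1) R_subset unfolding bij_betw_def by blast
  then show ?thesis using d diff_rep_mult_le[OF assms(1), of d] by (auto simp: rich_def)
qed

text \<open>Differences in H = \<open>rich \<tau>\<close> have at least |H| \<tau> representations
  in all. Sending (d, s) to (s, s/d) puts them into R times Y, where Y lies over the values d^(-t).
  As H is a union of cosets there are at most |H|/t such values, so assumption \<open>B\<close>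
  implies the corresponding one of \<open>stepanov_bound\<close>.\<close>

lemma stepanov_rich:
  assumes AB: "A * B \<le> card R" and B: "2 * card (rich \<tau>) * A < card R * B\<^sup>2"
    and tB: "card R * B \<le> p"
  shows "A * (card (rich \<tau>) * \<tau>) \<le> card R * (A + 2 * card R * B)"
proof -
  define t where "t = card R"
  define H where "H = rich \<tau>"
  have Hp: "d \<in> {1..<p}" if "d \<in> H" for d using that by (auto simp: H_def rich_def)
  have [simp]: "finite H" by (simp add: H_def)
  obtain iv where iv: "\<And>d. d \<in> {1..<p} \<Longrightarrow> iv d \<in> {1..<p} \<and> [d * iv d = 1] (mod p)"
    using unit_inverse by blast
  define \<beta> where "\<beta> d = (iv d ^ t) mod p" for d
  define F where "F d = {s \<in> R. (s + d) mod p \<in> R}" for d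
  \<comment> \<open>A solution s + d = r in R is recorded by y = s / d, for which y ^ t = (y + 1) ^ t = d ^ (-t).\<close>
  define Y where "Y = {y \<in> {1..<p}. \<not> p dvd y + 1 \<and>
      (\<exists>z\<in>\<beta> ` H. [y ^ t = z] (mod p) \<and> [(y + 1) ^ t = z] (mod p))}"
  have [simp]: "finite Y" by (simp add: Y_def)
  have power_coset: "[(r * iv d) ^ t = \<beta> d] (mod p)" if "r \<in> R" for r d
  proof -
    have "[r ^ t * iv d ^ t = 1 * iv d ^ t] (mod p)"
      using power_card_R[OF that] by (intro cong_mult) (auto simp: t_def)
    then show ?thesis by (simp add: \<beta>_def power_mult_distrib cong_def)
  qed
  have "card H * \<tau> \<le> (\<Sum>d\<in>H. diff_rep d)"
    using sum_mono[of H "\<lambda>_. \<tau>" diff_rep] by (simp add: H_def rich_def)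
  also have "\<dots> = card (SIGMA d:H. F d)"
    using finite_R by (simp add: F_def diff_rep_def)
  also have "\<dots> \<le> card (R \<times> Y)"
  proof (rule card_inj_on_le)
    show "inj_on (\<lambda>(d, s). (s, (s * iv d) mod p)) (SIGMA d:H. F d)"
    proof (rule inj_onI)
      fix u v assume u: "u \<in> (SIGMA d:H. F d)" and v: "v \<in> (SIGMA d:H. F d)"
        and uv: "(case u of (d, s) \<Rightarrow> (s, (s * iv d) mod p)) = (case v of (d, s) \<Rightarrow> (s, (s * iv d) mod p))"
      obtain d s d' where us: "u = (d, s)" "v = (d', s)" using uv by (cases u; cases v) simp
      have d: "d \<in> H" "d' \<in> H" and s: "s \<in> R" using u v by (auto simp: us F_def)
      have eq: "(s * iv d) mod p = (s * iv d') mod p" using uv by (simp add: us)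
      note iv_d = iv[OF Hp[OF d(1)]] iv[OF Hp[OF d(2)]]
      have "iv d = iv d'"
        using inj_onD[OF mult_mod_inj[OF coprime_R[OF s]] eq] iv_d by simp
      then have "[d * iv d = d' * iv d] (mod p)"
        using iv_d cong_trans cong_sym by metis
      moreover have "coprime (iv d) p" using coprime_p iv_d by blast
      ultimately have "[d = d'] (mod p)" using cong_mult_rcancel_nat by blast
      then show "u = v" using Hp[OF d(1)] Hp[OF d(2)] by (simp add: cong_def us)
    qed
    show "(\<lambda>(d, s). (s, (s * iv d) mod p)) ` (SIGMA d:H. F d) \<subseteq> R \<times> Y"
    proof clarify
      fix d s assume d: "d \<in> H" and s: "s \<in> F d"
      define r where "r = (s + d) mod p"
      define y where "y = (s * iv d) mod p"
      have sr: "s \<in> R" "r \<in> R" using s by (auto simp: F_def r_def)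
      have y: "y \<in> {1..<p}"
        using mult_mod_bij_units[of s] sr R_subset iv[OF Hp[OF d]] unfolding bij_betw_def y_def by blast
      have "[y + 1 = s * iv d + d * iv d] (mod p)"
        using iv[OF Hp[OF d]] by (intro cong_add) (auto simp: y_def cong_def)
      also have "s * iv d + d * iv d = (s + d) * iv d" by (simp add: distrib_right)
      also have "[(s + d) * iv d = r * iv d] (mod p)"
        by (simp add: r_def cong_def mod_mult_left_eq)
      finally have y1: "[y + 1 = r * iv d] (mod p)" .
      have "\<not> p dvd r * iv d"
        using subsetD[OF R_subset sr(2)] iv[OF Hp[OF d]] prime_p
        by (auto simp: prime_dvd_mult_iff dest: dvd_imp_le)
      then have 1: "\<not> p dvd y + 1" using y1 cong_dvd_iff by blast
      have "[y ^ t = (s * iv d) ^ t] (mod p)" by (intro cong_pow) (simp add: y_def)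
      then have 2: "[y ^ t = \<beta> d] (mod p)" using power_coset[OF sr(1)] cong_trans by blast
      have 3: "[(y + 1) ^ t = \<beta> d] (mod p)"
        using cong_pow[OF y1] power_coset[OF sr(2)] cong_trans by blast
      show "s \<in> R \<and> (s * iv d) mod p \<in> Y"
        using sr y 1 2 3 d unfolding y_def[symmetric] Y_def by blast
    qed
  qed (simp add: finite_R)
  finally have hY: "card H * \<tau> \<le> t * card Y" by (simp add: card_cartesian_product t_def)
  have "t * card (\<beta> ` H) \<le> card H"
  proof -
    have fibre: "t \<le> card {d \<in> H. \<beta> d = z}" if z: "z \<in> \<beta> ` H" for z
    proof -
      obtain d where d: "d \<in> H" "z = \<beta> d" using z by blast
      have "card ((\<lambda>r. (d * r) mod p) ` R) \<le> card {d \<in> H. \<beta> d = z}"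
      proof (rule card_mono)
        show "(\<lambda>r. (d * r) mod p) ` R \<subseteq> {d \<in> H. \<beta> d = z}"
        proof clarify
          fix r assume r: "r \<in> R"
          define d' where "d' = (d * r) mod p"
          have d': "d' \<in> H" using rich_mult[OF r] d(1) by (simp add: H_def d'_def)
          have inverse: "[d ^ t * iv d ^ t = 1] (mod p)" if "d \<in> H" for d
            using cong_pow[of "d * iv d" 1 p t] iv[OF Hp[OF that]] by (simp add: power_mult_distrib)
          have "[d' ^ t = (d * r) ^ t] (mod p)" by (intro cong_pow) (simp add: d'_def)
          also have "(d * r) ^ t = d ^ t * r ^ t" by (rule power_mult_distrib)
          also have "[d ^ t * r ^ t = d ^ t * 1] (mod p)"
            using power_card_R[OF r] by (intro cong_mult) (auto simp: t_def)
          finally have dd': "[d' ^ t = d ^ t] (mod p)" by simp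
          have "[iv d' ^ t * 1 = iv d' ^ t * (d ^ t * iv d ^ t)] (mod p)"
            using inverse[OF d(1)] by (intro cong_mult) (auto simp: cong_sym_eq)
          also have "[iv d' ^ t * (d ^ t * iv d ^ t) = iv d' ^ t * (d' ^ t * iv d ^ t)] (mod p)"
            using dd' by (intro cong_mult) (auto simp: cong_sym_eq)
          also have "iv d' ^ t * (d' ^ t * iv d ^ t) = (d' ^ t * iv d' ^ t) * iv d ^ t" by simp
          also have "[(d' ^ t * iv d' ^ t) * iv d ^ t = 1 * iv d ^ t] (mod p)"
            using inverse[OF d'] by (intro cong_mult) auto
          finally have "\<beta> d' = \<beta> d" by (simp add: \<beta>_def cong_def)
          then show "d' \<in> H \<and> \<beta> d' = z" using d' d(2) by simp
        qed
      qed simp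
      moreover have "card ((\<lambda>r. (d * r) mod p) ` R) = t"
        unfolding t_def
        by (intro card_image inj_on_subset[OF mult_mod_inj[OF coprime_p[OF Hp[OF d(1)]]]])
          (use R_subset in auto)
      ultimately show ?thesis by simp
    qed
    have "t * card (\<beta> ` H) = (\<Sum>z\<in>\<beta> ` H. t)" by simp
    also have "\<dots> \<le> (\<Sum>z\<in>\<beta> ` H. card {d \<in> H. \<beta> d = z})" using fibre by (rule sum_mono)
    also have "\<dots> = card H"
      using sum.group[of H "\<beta> ` H" \<beta> "\<lambda>_. 1 :: nat"] by simp
    finally show ?thesis .
  qed
  then have "2 * (t * card (\<beta> ` H)) * A \<le> 2 * card H * A" by (intro mult_le_mono) auto
  also have "\<dots> < t * B\<^sup>2" using B by (simp add: H_def t_def)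
  finally have "t * (2 * card (\<beta> ` H) * A) < t * B\<^sup>2" by (simp add: mult_ac)
  then have Z: "2 * card (\<beta> ` H) * A < B\<^sup>2" by simp
  have "A * card (int ` Y) \<le> A + 2 * t * B"
  proof (rule stepanov_bound[OF prime_p, where Z = "int ` \<beta> ` H"])
    show "2 * card (int ` \<beta> ` H) * A < B\<^sup>2" using Z by (simp add: card_image)
    show "A * B \<le> t" "t * B \<le> p" using AB tB by (simp_all add: t_def)
    show "int ` Y \<subseteq> {0..<int p}" by (auto simp: Y_def)
  next
    fix y assume "y \<in> int ` Y"
    then obtain x where x: "y = int x" "x \<in> Y" by blast
    then have "\<not> p dvd x" "\<not> p dvd x + 1" by (auto simp: Y_def dest: dvd_imp_le)
    then have "\<not> int p dvd int x" "\<not> int p dvd int (x + 1)" unfolding of_nat_dvd_iff by auto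
    then show "\<not> int p dvd y \<and> \<not> int p dvd y + 1" by (simp add: x add.commute)
    obtain z where z: "z \<in> \<beta> ` H" "[x ^ t = z] (mod p)" "[(x + 1) ^ t = z] (mod p)"
      using x(2) by (auto simp: Y_def)
    then have "[int (x ^ t) = int z] (mod int p)" "[int ((x + 1) ^ t) = int z] (mod int p)"
      unfolding cong_int_iff by auto
    then have "int p dvd y ^ t - int z" "int p dvd (y + 1) ^ t - int z"
      by (simp_all add: x cong_iff_dvd_diff add.commute)
    then show "\<exists>z\<in>int ` \<beta> ` H. int p dvd y ^ t - z \<and> int p dvd (y + 1) ^ t - z"
      using z(1) by blast
  qed simp
  then have AY: "A * card Y \<le> A + 2 * t * B" by (simp add: card_image)
  have "A * (card H * \<tau>) \<le> A * (t * card Y)" using hY by (rule mult_le_mono2)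
  also have "\<dots> = t * (A * card Y)" by simp
  also have "\<dots> \<le> t * (A + 2 * t * B)" using AY by (rule mult_le_mono2)
  finally show ?thesis by (simp only: H_def t_def)
qed

text \<open>With B of order t / A, \<open>stepanov_rich\<close> gives A^2 h \<tau> \<le> 3 t^3; for
  A of order t / h^(1/3) this is \<tau>^3 h = O(t^3), with constant 64^2 * 3^3. From \<tau>^2 \<ge>
  t and the trivial h \<tau> \<le> t^2 comes h^2 \<le> t^3, hence t B \<le> 4 t^(3/2) \<le> p by the
  hypothesis on p.\<close>

lemma card_rich_le:
  assumes t: "4 < card R" and p: "16 * card R ^ 3 \<le> p\<^sup>2" and \<tau>: "card R \<le> \<tau>\<^sup>2"
  shows "\<tau> ^ 3 * card (rich \<tau>) \<le> 110592 * card R ^ 3"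
proof (cases "rich \<tau> = {}")
  case False
  define t where "t = card R"
  define h where "h = card (rich \<tau>)"
  have h: "0 < h" using False by (simp add: h_def card_gt_0_iff)
  have t0: "0 < t" using t by (simp add: t_def)
  have "h * \<tau> \<le> (\<Sum>d\<in>rich \<tau>. diff_rep d)"
    unfolding h_def using sum_mono[of "rich \<tau>" "\<lambda>_. \<tau>" diff_rep] by (simp add: rich_def)
  also have "\<dots> \<le> (\<Sum>d<p. diff_rep d)"
    by (intro sum_mono2) (auto simp: rich_def)
  finally have "h * \<tau> \<le> t\<^sup>2" by (simp add: sum_diff_rep t_def)
  then have ht: "(h * \<tau>)\<^sup>2 \<le> (t\<^sup>2)\<^sup>2" by (rule power_mono) simp
  have "t * h\<^sup>2 \<le> \<tau>\<^sup>2 * h\<^sup>2" using \<tau> by (intro mult_le_mono1) (simp add: t_def)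
  also have "\<dots> = (h * \<tau>)\<^sup>2" by (simp add: power_mult_distrib)
  also have "\<dots> \<le> (t\<^sup>2)\<^sup>2" by (rule ht)
  also have "\<dots> = t * t ^ 3" by (simp add: power2_eq_square power3_eq_cube)
  finally have h2: "h\<^sup>2 \<le> t ^ 3" using t0 by simp
  \<comment> \<open>This makes A = 1 admissible, so that the largest A is positive; it rests on t >
    4.\<close>
  have h8: "8 * h < t ^ 3"
  proof -
    have "4 ^ 3 < t ^ 3" using t by (intro power_strict_mono) (auto simp: t_def)
    then have "64 * t ^ 3 < t ^ 3 * t ^ 3" using t0 by (intro mult_strict_right_mono) auto
    moreover have "(8 * h)\<^sup>2 \<le> 64 * t ^ 3" using h2 by (simp add: power_mult_distrib)
    ultimately have "(8 * h)\<^sup>2 < (t ^ 3)\<^sup>2" by (simp add: power2_eq_square)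
    then show ?thesis by (rule power_less_imp_less_base) simp
  qed
  \<comment> \<open>A is the largest integer with 8 h A^3 < t^3, so that B = t div A satisfies the
    hypotheses of the Stepanov bound and A has order t / h^(1/3).\<close>
  define k where "k = (LEAST k. t ^ 3 \<le> 8 * h * k ^ 3)"
  have "t ^ 3 \<le> 8 * h * t ^ 3" using h by simp
  then have k: "t ^ 3 \<le> 8 * h * k ^ 3" unfolding k_def by (rule LeastI)
  have "k \<noteq> 0"
  proof
    assume "k = 0"
    then show False using k t0 by simp
  qed
  moreover have "k \<noteq> 1"
  proof
    assume "k = 1"
    then show False using k h8 by simp
  qed
  ultimately obtain A where A: "k = Suc A" "0 < A" by (cases k) auto
  have A1: "8 * h * A ^ 3 < t ^ 3"
    using not_less_Least[of A "\<lambda>k. t ^ 3 \<le> 8 * h * k ^ 3"] A by (simp add: k_def[symmetric])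
  \<comment> \<open>As A \<ge> 1, k = A + 1 \<le> 2A; the rounding turns the factor 8 into
    64.\<close>
  have "k ^ 3 \<le> (2 * A) ^ 3" using A by (intro power_mono) auto
  then have "8 * h * k ^ 3 \<le> 8 * h * (2 * A) ^ 3" by (rule mult_le_mono2)
  from order.trans[OF k this] have A2: "t ^ 3 \<le> 64 * h * A ^ 3"
    by (simp add: power_mult_distrib)
  have At: "A \<le> t"
  proof -
    have "A ^ 3 \<le> 8 * h * A ^ 3" using h by simp
    then have "A ^ 3 < t ^ 3" using A1 by (rule le_less_trans)
    then show ?thesis by (simp add: power_less_imp_less_base less_imp_le)
  qed
  define B where "B = t div A"
  have AB: "A * B \<le> t" by (simp add: B_def)
  have "0 < B" using At A(2) by (simp add: B_def div_greater_zero_iff)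
  have tA: "t < 2 * (A * B)"
  proof -
    have "t < A * Suc B" using A(2) by (simp add: B_def dividend_less_times_div)
    also have "\<dots> \<le> A * (2 * B)" using \<open>0 < B\<close> by (intro mult_le_mono2) simp
    finally show ?thesis by simp
  qed
  have B: "2 * h * A < t * B\<^sup>2"
  proof -
    have "4 * A\<^sup>2 * (2 * h * A) = 8 * h * A ^ 3" by (simp add: power2_eq_square power3_eq_cube)
    also have "\<dots> < t * t\<^sup>2" using A1 by (simp add: power2_eq_square power3_eq_cube)
    also have "\<dots> \<le> t * (2 * (A * B))\<^sup>2" using tA by (intro mult_le_mono2 power_mono) auto
    also have "\<dots> = 4 * A\<^sup>2 * (t * B\<^sup>2)" by (simp add: power_mult_distrib)
    finally show ?thesis by (simp add: mult_ac)
  qed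
  have tB: "t * B \<le> p"
  proof -
    have "t ^ 3 * (t * B) ^ 3 \<le> 64 * h * A ^ 3 * (t * B) ^ 3" using A2 by (rule mult_le_mono1)
    also have "\<dots> = 64 * h * t ^ 3 * (A * B) ^ 3" by (simp add: power_mult_distrib)
    also have "\<dots> \<le> 64 * h * t ^ 3 * t ^ 3" using AB by (intro mult_le_mono2 power_mono) auto
    finally have "(t * B) ^ 3 \<le> 64 * h * t ^ 3" using t0 by simp
    then have "((t * B) ^ 3)\<^sup>2 \<le> (64 * h * t ^ 3)\<^sup>2" by (rule power_mono) simp
    also have "\<dots> = 4096 * h\<^sup>2 * (t ^ 3)\<^sup>2" by (simp add: power_mult_distrib)
    also have "\<dots> \<le> 4096 * t ^ 3 * (t ^ 3)\<^sup>2" using h2 by (intro mult_le_mono1 mult_le_mono2)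
    also have "\<dots> = (16 * t ^ 3) ^ 3" by (simp add: power_mult_distrib power2_eq_square power3_eq_cube)
    also have "\<dots> \<le> (p\<^sup>2) ^ 3" using p by (intro power_mono) (auto simp: t_def)
    finally have "(t * B) ^ 6 \<le> p ^ 6" by (simp flip: power_mult)
    then show ?thesis by simp
  qed
  have "A * (h * \<tau>) \<le> t * (A + 2 * t * B)"
    using stepanov_rich[of A B \<tau>] AB B tB by (simp add: h_def t_def)
  then have "A * (A * (h * \<tau>)) \<le> A * (t * (A + 2 * t * B))" by (rule mult_le_mono2)
  also have "\<dots> = t * (A\<^sup>2 + 2 * t * (A * B))" by (simp add: power2_eq_square algebra_simps)
  also have "\<dots> \<le> t * (t\<^sup>2 + 2 * t * t)" using At AB by (intro mult_le_mono2 add_mono power_mono) auto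
  finally have "A\<^sup>2 * h * \<tau> \<le> 3 * t ^ 3" by (simp add: power2_eq_square power3_eq_cube mult_ac)
  then have 1: "(A\<^sup>2 * h * \<tau>) ^ 3 \<le> (3 * t ^ 3) ^ 3" by (rule power_mono) simp
  \<comment> \<open>\<open>A2\<close> eliminates A, and the common factor h^2 t^6 cancels at the
    end.\<close>
  have "h\<^sup>2 * (t ^ 3)\<^sup>2 * (\<tau> ^ 3 * h) = h ^ 3 * \<tau> ^ 3 * (t ^ 3)\<^sup>2"
    by (simp add: power2_eq_square power3_eq_cube)
  also have "\<dots> \<le> h ^ 3 * \<tau> ^ 3 * (64 * h * A ^ 3)\<^sup>2"
    using A2 by (intro mult_le_mono2 power_mono) auto
  also have "\<dots> = 4096 * h\<^sup>2 * (A\<^sup>2 * h * \<tau>) ^ 3"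
    by (simp add: power_mult_distrib power2_eq_square power3_eq_cube)
  also have "\<dots> \<le> 4096 * h\<^sup>2 * (3 * t ^ 3) ^ 3" using 1 by (rule mult_le_mono2)
  also have "\<dots> = h\<^sup>2 * (t ^ 3)\<^sup>2 * (110592 * t ^ 3)"
    by (simp add: power_mult_distrib power2_eq_square power3_eq_cube)
  finally show ?thesis using h t0 by (simp add: h_def t_def)
qed simp

lemma diff_rep_le: "diff_rep d \<le> card R"
  unfolding diff_rep_def using finite_R by (intro card_mono) auto

lemma energy_le_cube: "energy \<le> card R ^ 3"
proof -
  have "energy \<le> (\<Sum>d<p. card R * diff_rep d)"
    unfolding energy_def using diff_rep_le by (intro sum_mono) (simp add: power2_eq_square)
  also have "\<dots> = card R ^ 3"
    by (simp add: sum_distrib_left[symmetric] sum_diff_rep power2_eq_square power3_eq_cube)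
  finally show ?thesis .
qed

text \<open>The constant is 2 for the counts up to s \<le> 2 sqrt t, plus 221184 = 2 * 110592 for
  the layers above s, plus 1 for d = 0.\<close>

lemma energy_le:
  assumes p: "16 * card R ^ 3 \<le> p\<^sup>2"
  shows "real energy \<le> 221187 * (real (card R))\<^sup>2 * sqrt (real (card R))"
proof -
  define t where "t = real (card R)"
  have t: "1 \<le> t" using card_R_pos by (simp add: t_def)
  have sqrt1: "1 \<le> sqrt t" using t by simp
  show ?thesis
  proof (cases "card R \<le> 4")
    case True
    \<comment> \<open>\<open>card_rich_le\<close> assumes |R| > 4; up to 4 the trivial bound t^3
      suffices.\<close>
    then have "sqrt t \<le> 2" by (intro real_le_lsqrt) (simp_all add: t_def)
    have "real energy \<le> t ^ 3"
      using energy_le_cube by (simp add: t_def flip: of_nat_power)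
    also have "\<dots> = t\<^sup>2 * (sqrt t * sqrt t)" using t by (simp add: power2_eq_square power3_eq_cube)
    also have "\<dots> \<le> t\<^sup>2 * (221187 * sqrt t)"
      using \<open>sqrt t \<le> 2\<close> sqrt1 by (intro mult_left_mono mult_right_mono) auto
    finally show ?thesis by (simp add: t_def)
  next
    case False
    \<comment> \<open>This cut balances s t^2 against t^3 / s, and from s on the hypothesis on
      \<tau> in \<open>card_rich_le\<close> holds.\<close>
    define s where "s = nat \<lceil>sqrt t\<rceil>"
    have s1: "sqrt t \<le> real s" unfolding s_def by linarith
    have s2: "real s \<le> 2 * sqrt t" unfolding s_def using sqrt1 by linarith
    have s0: "0 < s" using s1 sqrt1 by (cases s) auto
    have "(sqrt t)\<^sup>2 \<le> (real s)\<^sup>2" using s1 sqrt1 by (intro power_mono) auto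
    then have "t \<le> real (s\<^sup>2)" using t by simp
    then have s_sq: "card R \<le> s\<^sup>2" unfolding t_def by (simp only: of_nat_le_iff)
    have layer: "real (2 * \<tau> * card (rich \<tau>)) \<le> 221184 * t ^ 3 * (1 / (real \<tau>)\<^sup>2)"
      if "\<tau> \<in> {s<..card R}" for \<tau>
    proof -
      have \<tau>: "0 < \<tau>" "s \<le> \<tau>" using that by auto
      have "s\<^sup>2 \<le> \<tau>\<^sup>2" using \<tau> by (intro power_mono) auto
      then have "\<tau> ^ 3 * card (rich \<tau>) \<le> 110592 * card R ^ 3"
        using False p order.trans[OF s_sq] by (intro card_rich_le) auto
      then have "real (\<tau> ^ 3 * card (rich \<tau>)) \<le> real (110592 * card R ^ 3)"
        by (simp only: of_nat_le_iff)
      then have "real \<tau> ^ 3 * real (card (rich \<tau>)) \<le> 110592 * t ^ 3" by (simp add: t_def)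
      then show ?thesis using \<tau> by (simp add: field_simps power2_eq_square power3_eq_cube)
    qed
    have "(\<Sum>d\<in>{1..<p}. (diff_rep d)\<^sup>2)
        \<le> (\<Sum>d\<in>{1..<p}. s * diff_rep d + (\<Sum>\<tau>\<in>{s<..card R}. if d \<in> rich \<tau> then 2 * \<tau> else 0))"
    proof (intro sum_mono)
      fix d assume d: "d \<in> {1..<p}"
      have "(\<Sum>\<tau>\<in>{s<..diff_rep d}. 2 * \<tau>) = (\<Sum>\<tau>\<in>{s<..card R}. if d \<in> rich \<tau> then 2 * \<tau> else 0)"
        using d diff_rep_le[of d]
        by (intro sum.mono_neutral_cong_left) (auto simp: rich_def)
      then show "(diff_rep d)\<^sup>2 \<le> s * diff_rep d + (\<Sum>\<tau>\<in>{s<..card R}. if d \<in> rich \<tau> then 2 * \<tau> else 0)"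
        using square_le_layers[of "diff_rep d" s] by simp
    qed
    also have "\<dots> = s * (\<Sum>d\<in>{1..<p}. diff_rep d)
        + (\<Sum>\<tau>\<in>{s<..card R}. \<Sum>d\<in>{1..<p}. if d \<in> rich \<tau> then 2 * \<tau> else 0)"
      unfolding sum.distrib sum_distrib_left by (subst sum.swap) (rule refl)
    also have "(\<Sum>\<tau>\<in>{s<..card R}. \<Sum>d\<in>{1..<p}. if d \<in> rich \<tau> then 2 * \<tau> else 0)
        = (\<Sum>\<tau>\<in>{s<..card R}. 2 * \<tau> * card (rich \<tau>))"
    proof (intro sum.cong refl)
      fix \<tau>
      have "{1..<p} \<inter> rich \<tau> = rich \<tau>" by (auto simp: rich_def)
      then show "(\<Sum>d\<in>{1..<p}. if d \<in> rich \<tau> then 2 * \<tau> else 0) = 2 * \<tau> * card (rich \<tau>)"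
        by (simp add: sum.inter_restrict[symmetric])
    qed
    also have "(\<Sum>d\<in>{1..<p}. diff_rep d) \<le> (\<Sum>d<p. diff_rep d)" by (intro sum_mono2) auto
    also have "\<dots> = (card R)\<^sup>2" by (rule sum_diff_rep)
    finally have "real (\<Sum>d\<in>{1..<p}. (diff_rep d)\<^sup>2)
        \<le> real (s * (card R)\<^sup>2 + (\<Sum>\<tau>\<in>{s<..card R}. 2 * \<tau> * card (rich \<tau>)))"
      by (simp only: of_nat_le_iff) simp
    also have "\<dots> = real s * t\<^sup>2 + (\<Sum>\<tau>\<in>{s<..card R}. real (2 * \<tau> * card (rich \<tau>)))"
      by (simp add: t_def)
    also have "\<dots> \<le> 2 * sqrt t * t\<^sup>2 + 221184 * t ^ 3 * (1 / sqrt t)"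
    proof (intro add_mono mult_right_mono s2)
      have "(\<Sum>\<tau>\<in>{s<..card R}. real (2 * \<tau> * card (rich \<tau>)))
          \<le> 221184 * t ^ 3 * (\<Sum>\<tau>\<in>{s<..card R}. 1 / (real \<tau>)\<^sup>2)"
        unfolding sum_distrib_left using layer by (rule sum_mono)
      also have "(\<Sum>\<tau>\<in>{s<..card R}. 1 / (real \<tau>)\<^sup>2) \<le> 1 / real s"
      proof (cases "s \<le> card R")
        case True
        have "0 \<le> 1 / real (card R)" by simp
        then show ?thesis using sum_inverse_squares_le[OF s0 True] by linarith
      qed simp
      also have "1 / real s \<le> 1 / sqrt t" using s1 sqrt1 s0 by (intro divide_left_mono mult_pos_pos) auto
      finally show "(\<Sum>\<tau>\<in>{s<..card R}. real (2 * \<tau> * card (rich \<tau>))) \<le> 221184 * t ^ 3 * (1 / sqrt t)"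
        using t by (simp add: mult_left_mono)
    qed simp
    also have "221184 * t ^ 3 * (1 / sqrt t) = 221184 * t\<^sup>2 * sqrt t"
    proof -
      have "221184 * t ^ 3 * (1 / sqrt t) = 221184 * t\<^sup>2 * (t / sqrt t)"
        by (simp add: power2_eq_square power3_eq_cube)
      then show ?thesis using t by (simp add: real_div_sqrt)
    qed
    finally have 1: "real (\<Sum>d\<in>{1..<p}. (diff_rep d)\<^sup>2) \<le> 221186 * t\<^sup>2 * sqrt t"
      by (simp add: algebra_simps)
    have "{..<p} = insert 0 {1..<p}" using p_pos by auto
    then have "real energy = (real (diff_rep 0))\<^sup>2 + real (\<Sum>d\<in>{1..<p}. (diff_rep d)\<^sup>2)"
      unfolding energy_def by simp
    also have "\<dots> \<le> t\<^sup>2 * sqrt t + 221186 * t\<^sup>2 * sqrt t"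
    proof (intro add_mono 1)
      have "(real (diff_rep 0))\<^sup>2 \<le> t\<^sup>2" using diff_rep_le by (intro power_mono) (auto simp: t_def)
      also have "\<dots> \<le> t\<^sup>2 * sqrt t" using sqrt1 by (simp add: mult_le_cancel_left1)
      finally show "(real (diff_rep 0))\<^sup>2 \<le> t\<^sup>2 * sqrt t" .
    qed
    finally show ?thesis by (simp add: t_def mult_ac)
  qed
qed

lemma energy_square_le:
  assumes "16 * card R ^ 3 \<le> p\<^sup>2"
  shows "(real energy)\<^sup>2 \<le> 221187\<^sup>2 * real (card R) ^ 5"
proof -
  have "(real energy)\<^sup>2 \<le> (221187 * (real (card R))\<^sup>2 * sqrt (real (card R)))\<^sup>2"
    using energy_le[OF assms] by (intro power_mono) auto
  also have "\<dots> = 221187\<^sup>2 * (((real (card R))\<^sup>2)\<^sup>2 * real (card R))"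
    by (simp add: power_mult_distrib)
  also have "((real (card R))\<^sup>2)\<^sup>2 * real (card R) = real (card R) ^ 5"
    by (simp add: eval_nat_numeral)
  finally show ?thesis .
qed

section \<open>From the moment inequalities to the two sumset bounds\<close>

lemma sumset_covers_if_weil:
  assumes l: "2 \<le> l" and large: "real p powr ((real l + 1) / (2 * real l)) < real (card R)"
  shows "{1..<p} \<subseteq> sumset_mod p l R"
proof (rule ccontr)
  assume "\<not> {1..<p} \<subseteq> sumset_mod p l R"
  then obtain a where a: "a \<in> {1..<p}" "a \<notin> sumset_mod p l R" by blast
  define t where "t = real (card R)"
  have t: "0 < t" using card_R_pos by (simp add: t_def)
  have "norm (S (int \<xi>)) \<le> sqrt (real p)" if "\<xi> \<in> {1..<p}" for \<xi>
    using norm_S_square_le[OF that] by (rule real_le_rsqrt)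
  \<comment> \<open>k = 1 leaves the second moment pt; dividing by t and squaring gives t^(2l) \<le>
    p^(l+1), against the hypothesis.\<close>
  from missing_imp_moment_ge[OF a _ this, of 1]
  have "t ^ Suc l \<le> sqrt (real p) ^ (l - 1) * (\<Sum>\<xi><p. (norm (S (int \<xi>)))\<^sup>2)"
    using l by (simp add: t_def numeral_2_eq_2)
  then have "t * t ^ l \<le> t * (sqrt (real p) ^ (l - 1) * real p)"
    by (simp add: sum_norm_S_square t_def mult_ac)
  then have "t ^ l \<le> sqrt (real p) ^ (l - 1) * real p" using t by simp
  then have "(t ^ l)\<^sup>2 \<le> (sqrt (real p) ^ (l - 1) * real p)\<^sup>2" using t by (intro power_mono) auto
  also have "\<dots> = ((sqrt (real p))\<^sup>2) ^ (l - 1) * (real p)\<^sup>2"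
    by (simp only: power_mult_distrib power_mult[symmetric] mult.commute)
  also have "\<dots> = real p ^ (l - 1 + 2)" by (simp only: power_add) simp
  also have "l - 1 + 2 = l + 1" using l by simp
  finally have 1: "t ^ (2 * l) \<le> real p ^ (l + 1)" by (simp add: power_mult[symmetric] mult.commute)
  have "(real p powr ((real l + 1) / (2 * real l))) ^ (2 * l) < t ^ (2 * l)"
    using large l by (intro power_strict_mono) (auto simp: t_def)
  moreover have "(real p powr ((real l + 1) / (2 * real l))) ^ (2 * l) = real p ^ (l + 1)"
    using powr_divide_power[of "real p" "2 * l" "l + 1"] p_pos l by (simp add: add.commute)
  ultimately show False using 1 by simp
qed

text \<open>The eighth power of t^(l+1) \<le> M^(l-3) p E involves only powers of M^8 and E^2.
  Inserting M^8 \<le> p^2 K^2 t^3 (from \<open>norm_S_power4_le\<close>) or M^8 \<le> p K^2 t^5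
  (from \<open>norm_S_power8_le\<close>) gives the two inequalities.\<close>

lemma missing_imp_card_bounds:
  assumes l: "4 \<le> l" and small: "16 * card R ^ 3 \<le> p\<^sup>2"
    and a: "a \<in> {1..<p}" "a \<notin> sumset_mod p l R"
  shows "real (card R) ^ (5 * l - 3) \<le> 221187 ^ (2 * l + 2) * real p ^ (2 * l + 2)"
    and "real (card R) ^ (3 * l + 3) \<le> 221187 ^ (2 * l + 2) * real p ^ (l + 5)"
proof -
  define t where "t = real (card R)"
  define K :: real where "K = 221187"
  define P where "P = real p"
  define E where "E = real energy"
  have pos: "0 < t" "0 < K" "0 < P" "0 \<le> E"
    using card_R_pos p_pos by (simp_all add: t_def K_def P_def E_def)
  have E: "E\<^sup>2 \<le> K\<^sup>2 * t ^ 5" using energy_square_le[OF small] by (simp add: E_def K_def t_def)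
  define M where "M = Max ((\<lambda>\<xi>. norm (S (int \<xi>))) ` {1..<p})"
  have "M \<in> (\<lambda>\<xi>. norm (S (int \<xi>))) ` {1..<p}" unfolding M_def using a by (intro Max_in) auto
  then obtain \<eta> where \<eta>: "\<eta> \<in> {1..<p}" "M = norm (S (int \<eta>))" by blast
  have M0: "0 \<le> M" using \<eta> by simp
  have "norm (S (int \<xi>)) \<le> M" if "\<xi> \<in> {1..<p}" for \<xi>
    unfolding M_def using that by (intro Max_ge) auto
  from missing_imp_moment_ge[OF a _ this, of 3]
  have "t ^ Suc l \<le> M ^ (l - 3) * (P * E)"
    using l by (simp add: t_def P_def E_def flip: sum_norm_S_power4)
  then have "(t ^ Suc l) ^ 8 \<le> (M ^ (l - 3) * (P * E)) ^ 8" using pos by (intro power_mono) auto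
  also have "\<dots> = (M ^ 8) ^ (l - 3) * (P ^ 8 * (E\<^sup>2) ^ 4)"
    by (simp add: power_mult_distrib power_mult[symmetric] mult.commute)
  also have "\<dots> \<le> (M ^ 8) ^ (l - 3) * (P ^ 8 * (K\<^sup>2 * t ^ 5) ^ 4)"
    using E pos M0 by (intro mult_left_mono power_mono) auto
  also have "(K\<^sup>2 * t ^ 5) ^ 4 = K ^ 8 * t ^ 20"
    by (simp add: power_mult_distrib flip: power_mult)
  also have "(t ^ Suc l) ^ 8 = t ^ (8 * l + 8)"
    by (simp only: power_mult[symmetric]) (simp add: algebra_simps)
  finally have main: "t ^ (8 * l + 8) \<le> (M ^ 8) ^ (l - 3) * (P ^ 8 * K ^ 8 * t ^ 20)"
    by (simp only: mult.assoc)
  \<comment> \<open>In terms of m all exponents, such as 5l - 3 = 5m + 12, are free of truncated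
    subtraction.\<close>
  define m where "m = l - 3"
  have m: "l = m + 3" using l by (simp add: m_def)
  have "t * M ^ 4 \<le> P * E" using norm_S_power4_le[OF \<eta>(1)] by (simp add: \<eta>(2) t_def P_def E_def)
  then have "(t * M ^ 4)\<^sup>2 \<le> (P * E)\<^sup>2" using pos by (intro power_mono) auto
  also have "\<dots> \<le> P\<^sup>2 * (K\<^sup>2 * t ^ 5)" using E by (simp add: power_mult_distrib mult_left_mono)
  finally have "t\<^sup>2 * M ^ 8 \<le> t\<^sup>2 * (P\<^sup>2 * K\<^sup>2 * t ^ 3)"
    by (simp add: power_mult_distrib power_mult[symmetric] mult_ac flip: power_add)
  then have M1: "M ^ 8 \<le> P\<^sup>2 * K\<^sup>2 * t ^ 3" using pos by simp
  have "t ^ (3 * m + 20) * t ^ (5 * m + 12) = t ^ (8 * l + 8)" by (simp add: m add.commute flip: power_add)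
  also have "\<dots> \<le> (P\<^sup>2 * K\<^sup>2 * t ^ 3) ^ m * (P ^ 8 * K ^ 8 * t ^ 20)"
    using main M1 pos unfolding m
    by (elim order.trans) (auto intro!: mult_right_mono power_mono)
  also have "\<dots> = t ^ (3 * m + 20) * (K ^ (2 * m + 8) * P ^ (2 * m + 8))"
    by (simp add: power_mult_distrib power_add mult_ac flip: power_mult)
  finally have "t ^ (5 * m + 12) \<le> K ^ (2 * m + 8) * P ^ (2 * m + 8)" using pos by simp
  then show "real (card R) ^ (5 * l - 3) \<le> 221187 ^ (2 * l + 2) * real p ^ (2 * l + 2)"
    by (simp add: m t_def K_def P_def add.commute)
  have "M ^ 8 \<le> P * E\<^sup>2" using norm_S_power8_le[OF \<eta>(1)] by (simp add: \<eta>(2) P_def E_def)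
  also have "\<dots> \<le> P * (K\<^sup>2 * t ^ 5)" using E pos by (intro mult_left_mono) auto
  finally have M2: "M ^ 8 \<le> P * (K\<^sup>2 * t ^ 5)" .
  have "t ^ (5 * m + 20) * t ^ (3 * m + 12) = t ^ (8 * l + 8)" by (simp add: m add.commute flip: power_add)
  also have "\<dots> \<le> (P * (K\<^sup>2 * t ^ 5)) ^ m * (P ^ 8 * K ^ 8 * t ^ 20)"
    using main M2 pos unfolding m
    by (elim order.trans) (auto intro!: mult_right_mono power_mono)
  also have "\<dots> = t ^ (5 * m + 20) * (K ^ (2 * m + 8) * P ^ (m + 8))"
    by (simp add: power_mult_distrib power_add mult_ac flip: power_mult)
  finally have "t ^ (3 * m + 12) \<le> K ^ (2 * m + 8) * P ^ (m + 8)" using pos by simp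
  then show "real (card R) ^ (3 * l + 3) \<le> 221187 ^ (2 * l + 2) * real p ^ (l + 5)"
    by (simp add: m t_def K_def P_def add.commute)
qed

text \<open>Since k \<le> n, the constant 221187^k is at most 221187^n, so taking n-th roots leaves
  a constant below 2^32 that does not depend on l.\<close>

lemma card_less_if_power_le:
  fixes n m k :: nat
  assumes bound: "real (card R) ^ n \<le> 221187 ^ k * real p ^ m" and "k \<le> n" "0 < n"
  shows "real (card R) < 2 ^ 32 * real p powr (real m / real n)"
proof (rule ccontr)
  assume "\<not> real (card R) < 2 ^ 32 * real p powr (real m / real n)"
  then have "(2 ^ 32 * real p powr (real m / real n)) ^ n \<le> real (card R) ^ n"
    by (intro power_mono) auto
  moreover have "(real p powr (real m / real n)) ^ n = real p ^ m"
    using p_pos assms(3) by (simp add: powr_divide_power)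
  ultimately have "(2 ^ 32) ^ n * real p ^ m \<le> 221187 ^ k * real p ^ m"
    using bound by (simp add: power_mult_distrib)
  then have "(2 ^ 32) ^ n \<le> (221187 :: real) ^ k" using p_pos by simp
  also have "\<dots> \<le> 221187 ^ n" using assms(2) by (intro power_increasing) auto
  also have "(221187 :: real) ^ n < (2 ^ 32) ^ n" using assms(3) by (intro power_strict_mono) auto
  finally show False by simp
qed

text \<open>The constant 2^32 serves twice. It exceeds 221187, and, being 16^8, it absorbs the
  factor 16 in \<open>16 * card R ^ 3 \<le> p\<^sup>2\<close>: both powers of p are at least 1, so p
  > |R| \<ge> 2^32.\<close>

lemma sumset_covers_if_large:
  assumes l: "4 \<le> l"
    and large: "2 ^ 32 * min (real p powr ((2 * real l + 2) / (5 * real l - 3)))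
                     (real p powr ((real l + 5) / (3 * real l + 3))) \<le> real (card R)"
  shows "{1..<p} \<subseteq> sumset_mod p l R"
proof (rule ccontr)
  assume contr: "\<not> {1..<p} \<subseteq> sumset_mod p l R"
  then obtain a where a: "a \<in> {1..<p}" "a \<notin> sumset_mod p l R" by blast
  have p1: "1 \<le> real p" using p_pos by simp
  have "1 \<le> min (real p powr ((2 * real l + 2) / (5 * real l - 3)))
                     (real p powr ((real l + 5) / (3 * real l + 3)))"
    using p1 l by (intro min.boundedI ge_one_powr_ge_zero divide_nonneg_nonneg) auto
  then have "2 ^ 32 \<le> real (card R)"
    using order.trans[OF mult_left_mono large, of 1] by simp
  then have p32: "2 ^ 32 \<le> real p" using card_R_less by linarith
  \<comment> \<open>A missing element puts t at or below the threshold of part (ii), and (l+1)/(2l)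
    \<le> 5/8 for l \<ge> 4; then (16 t^3)^8 = 2^32 t^24 \<le> p * p^15.\<close>
  have "real (card R) \<le> real p powr ((real l + 1) / (2 * real l))"
    using sumset_covers_if_weil[of l] l contr by force
  also have "\<dots> \<le> real p powr (5 / 8)"
    using p1 l by (intro powr_mono) (auto simp: field_simps)
  finally have "real (card R) ^ 8 \<le> (real p powr (5 / 8)) ^ 8" by (intro power_mono) auto
  also have "\<dots> = real p ^ 5" using powr_divide_power[of "real p" 8 5] p_pos by simp
  finally have t8: "real (card R) ^ 8 \<le> real p ^ 5" .
  have "(16 * real (card R) ^ 3) ^ 8 = 2 ^ 32 * (real (card R) ^ 8) ^ 3"
    by (simp add: power_mult_distrib flip: power_mult)
  also have "\<dots> \<le> real p * (real p ^ 5) ^ 3"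
    using t8 p32 by (intro mult_mono power_mono) auto
  also have "\<dots> = ((real p)\<^sup>2) ^ 8" by (simp flip: power_mult power_Suc)
  finally have "16 * real (card R) ^ 3 \<le> (real p)\<^sup>2"
    by (subst (asm) power_mono_iff) auto
  then have "real (16 * card R ^ 3) \<le> real (p\<^sup>2)" by simp
  then have small: "16 * card R ^ 3 \<le> p\<^sup>2" by (simp only: of_nat_le_iff)
  have "real (card R) < 2 ^ 32 * real p powr (real (2 * l + 2) / real (5 * l - 3))"
    by (rule card_less_if_power_le[OF missing_imp_card_bounds(1)[OF l small a]]) (use l in auto)
  moreover have "real (card R) < 2 ^ 32 * real p powr (real (l + 5) / real (3 * l + 3))"
    by (rule card_less_if_power_le[OF missing_imp_card_bounds(2)[OF l small a]]) (use l in auto)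
  moreover have "real (5 * l - 3) = 5 * real l - 3" using l by (simp add: of_nat_diff)
  ultimately show False using large by (simp add: min_def add.commute split: if_splits)
qed

end

theorem theorem2p6:
  shows "(\<exists>C::real>0. \<forall>(p::nat) R (l::nat).
            prime p \<longrightarrow> mult_subgroup p R \<longrightarrow> l \<ge> 4 \<longrightarrow>
            real (card R) \<ge> C * min (real p powr ((2 * real l + 2) / (5 * real l - 3)))
                                    (real p powr ((real l + 5) / (3 * real l + 3))) \<longrightarrow>
            {1..<p} \<subseteq> sumset_mod p l R)
       \<and> (\<forall>(p::nat) R (l::nat).
            prime p \<longrightarrow> mult_subgroup p R \<longrightarrow> l \<ge> 2 \<longrightarrow>
            real (card R) > real p powr ((real l + 1) / (2 * real l)) \<longrightarrow>
            {1..<p} \<subseteq> sumset_mod p l R)"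
proof (intro conjI exI[of _ "2 ^ 32"] allI impI)
  fix p R l assume "prime p" "mult_subgroup p R"
  then interpret prime_subgroup p R by unfold_locales
  show "{1..<p} \<subseteq> sumset_mod p l R"
    if "l \<ge> 4" "real (card R) \<ge> 2 ^ 32 * min (real p powr ((2 * real l + 2) / (5 * real l - 3)))
                                    (real p powr ((real l + 5) / (3 * real l + 3)))"
    using that by (rule sumset_covers_if_large)
  show "{1..<p} \<subseteq> sumset_mod p l R"
    if "l \<ge> 2" "real (card R) > real p powr ((real l + 1) / (2 * real l))"
    using that by (rule sumset_covers_if_weil)
qed simp

end
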